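(* Let $w:\mathbb Z^d\to[0,\infty)$ be symmetric ($w(x)=w(-x)$) with $\sum_{x\in\mathbb Z^d}w(x)=1$, regarded as the translation-invariant weight $w_{x,y}=w(y-x)$. Suppose that $w(0)>\frac12$. For $x\in\mathbb T_L$ let $|x|_1$ denote the $\ell^1$ torus distance from $x$ to the origin. For every $A\in\{\mathrm{mdd},\mathrm{per}\}$ and for either choice $$F^A_{L,w}(x)=G^A_{L,w}(x)\qquad\text{or}\qquad F^A_{L,w}(x)=\mathbb P^A_{L,w}(x\in\mathcal L_0),$$ the following hold. 1. $\displaystyle\lim_{R\to\infty}\ \sup_L\sum_{x\in\mathbb T_L,\ |x|_1\ge R}F^A_{L,w}(x)=0.$ 2. If, for some $p>0$, $\sum_{x\in\mathbb Z^d}|x|_1^p\,w(x)<\infty$, then there exists $C_p<\infty$ such that, for all $L$ and all $x\in\mathbb T_L$, $F^A_{L,w}(x)\le C_p(1+|x|_1)^{-p}$. 3. If, for some $\eta>0$, $\sum_{x\in\mathbb Z^d}e^{\eta|x|_1}w(x)<\infty$, then there exist $C,c>0$ such that, for all $L$ and all $x\in\mathbb T_L$, $F^A_{L,w}(x)\le Ce^{-c|x|_1}$.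
   Context: $\mathbb T_L:=(\mathbb Z/L\mathbb Z)^d$. The periodised weights on $\mathbb T_L$ are $w^{(L)}_{x,y}:=\sum_{z\in\mathbb Z^d}w(y-x+Lz)$. Monomer double-dimer model (mdd). Let $V$ be a finite set with symmetric weights $w_{x,y}\ge0$, $x,y\in V$, and let $E$ be the set of unordered pairs $\{x,y\}$, $x\ne y$, with $w_{x,y}>0$. For $m\in\{0,1\}^E$ put $n_x(m):=\sum_{y:\{x,y\}\in E}m_{x,y}$. Let $\Omega$ be the set of $(m^1,m^2)\in\{0,1\}^E\times\{0,1\}^E$ with $n_x(m^1)=n_x(m^2)\in\{0,1\}$ for all $x\in V$. The measure $\mathbb P^{\mathrm{mdd}}$ on $\Omega$ gives $(m^1,m^2)$ probability proportional, with normalising constant $Z^{\mathrm{mdd}}$, to $\prod_{x\in V}w_{x,x}^{1-n_x(m^1)}\prod_{\{x,y\}\in E}w_{x,y}^{m^1_{x,y}+m^2_{x,y}}$. The multigraph in which $\{u,v\}\in E$ has multiplicity $m^1_{u,v}+m^2_{u,v}$ is a disjoint union of loops (possibly a doubled edge) and isolated vertices (monomers); $\mathcal L_x$ is the (vertex set of the) loop containing $x$, with $\mathcal L_x=\{x\}$ if $x$ is a monomer. For $x\neq y$ let $\Omega_{x,y}$ be the set of $(m^1,m^2)\in\{0,1\}^E\times\{0,1\}^E$ with $n_z(m^1)=n_z(m^2)\in\{0,1\}$ for $z\notin\{x,y\}$, $n_x(m^1)=n_y(m^1)=0$, $n_x(m^2)=n_y(m^2)=1$; then $$G^{\mathrm{mdd}}(x,y):=\frac1{Z^{\mathrm{mdd}}}\sum_{(m^1,m^2)\in\Omega_{x,y}}\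 \prod_{z\in V\setminus\{x,y\}}w_{z,z}^{1-n_z(m^1)}\prod_{\{u,v\}\in E}w_{u,v}^{m^1_{u,v}+m^2_{u,v}},$$ and $G^{\mathrm{mdd}}(x,x):=0$. Random lattice permutations (per). $\mathbb P^{\mathrm{per}}$ gives a permutation $\pi$ of $V$ probability $\frac1{Z^{\mathrm{per}}}\prod_{x\in V}w_{x,\pi(x)}$, with $Z^{\mathrm{per}}$ the normalising constant; $\mathcal L_x(\pi):=\{\pi^n(x):n\ge0\}$. For $x,y\in V$ (possibly equal) $G^{\mathrm{per}}(x,y):=\frac1{Z^{\mathrm{per}}}\sum_\pi\prod_{z\in V\setminus\{y\}}w_{z,\pi(z)}$, the sum over all bijections $\pi:V\setminus\{y\}\to V\setminus\{x\}$. The subscript $_{L,w}$ means that the model is taken on $V=\mathbb T_L$ with weights $w^{(L)}$; $G^A_{L,w}(x):=G^A_{L,w}(0,x)$. *)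

theory Defs
  imports "HOL-Analysis.Analysis" "HOL-Combinatorics.Permutations"
begin

section \<open>Monomer double-dimer model\<close>

definition edges :: "'a set \<Rightarrow> ('a \<Rightarrow> 'a \<Rightarrow> real) \<Rightarrow> 'a set set" where
  "edges V w = {{x, y} | x y. x \<in> V \<and> y \<in> V \<and> x \<noteq> y \<and> w x y > 0}"

text \<open>The weight of an unordered pair; well defined because \<open>w\<close> is symmetric
  (see \<open>edge_weight_doubleton\<close> below).\<close>

definition edge_weight :: "('a \<Rightarrow> 'a \<Rightarrow> real) \<Rightarrow> 'a set \<Rightarrow> real" where
  "edge_weight w e = (THE c. \<forall>x y. e = {x, y} \<longrightarrow> c = w x y)"

lemma edge_weight_doubleton:
  assumes "w x y = w y x"
  shows "edge_weight w {x, y} = w x y"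
  unfolding edge_weight_def
  by (rule the_equality) (use assms in \<open>auto simp: doubleton_eq_iff\<close>)

text \<open>The set \<open>{0,1}\<^sup>E\<close>; configurations take the value \<open>undefined\<close> off the edge set, so that
  distinct functions are distinct configurations.\<close>

definition dimer_configs :: "'a set \<Rightarrow> ('a \<Rightarrow> 'a \<Rightarrow> real) \<Rightarrow> ('a set \<Rightarrow> nat) set" where
  "dimer_configs V w = edges V w \<rightarrow>\<^sub>E {0, 1}"

definition dimer_degree ::
    "'a set \<Rightarrow> ('a \<Rightarrow> 'a \<Rightarrow> real) \<Rightarrow> ('a set \<Rightarrow> nat) \<Rightarrow> 'a \<Rightarrow> nat" where
  "dimer_degree V w m x = (\<Sum>y | y \<in> V \<and> {x, y} \<in> edges V w. m {x, y})"

definition mdd_configs ::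
    "'a set \<Rightarrow> ('a \<Rightarrow> 'a \<Rightarrow> real) \<Rightarrow> (('a set \<Rightarrow> nat) \<times> ('a set \<Rightarrow> nat)) set" where
  "mdd_configs V w =
     {(m1, m2) \<in> dimer_configs V w \<times> dimer_configs V w.
        \<forall>x\<in>V. dimer_degree V w m1 x = dimer_degree V w m2 x \<and> dimer_degree V w m1 x \<in> {0, 1}}"

text \<open>The monomer factors are taken over \<open>U\<close>: all of \<open>V\<close> for the measure, \<open>V\<close> without the two
  end points for the two-point function.\<close>

definition mdd_weight ::
    "'a set \<Rightarrow> ('a \<Rightarrow> 'a \<Rightarrow> real) \<Rightarrow> 'a set \<Rightarrow> ('a set \<Rightarrow> nat) \<times> ('a set \<Rightarrow> nat) \<Rightarrow> real" where
  "mdd_weight V w U = (\<lambda>(m1, m2).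
     (\<Prod>z\<in>U. w z z ^ (1 - dimer_degree V w m1 z)) *
     (\<Prod>e\<in>edges V w. edge_weight w e ^ (m1 e + m2 e)))"

definition mdd_Z :: "'a set \<Rightarrow> ('a \<Rightarrow> 'a \<Rightarrow> real) \<Rightarrow> real" where
  "mdd_Z V w = (\<Sum>m\<in>mdd_configs V w. mdd_weight V w V m)"

definition mdd_measure ::
    "'a set \<Rightarrow> ('a \<Rightarrow> 'a \<Rightarrow> real) \<Rightarrow> (('a set \<Rightarrow> nat) \<times> ('a set \<Rightarrow> nat)) measure" where
  "mdd_measure V w =
     point_measure (mdd_configs V w) (\<lambda>m. ennreal (mdd_weight V w V m / mdd_Z V w))"

text \<open>The loop through \<open>x\<close> is the connected component of \<open>x\<close> in the multigraph with edge
  multiplicities \<open>m1 + m2\<close>; for a monomer this is \<open>{x}\<close>.\<close>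

definition mdd_loop ::
    "'a set \<Rightarrow> ('a \<Rightarrow> 'a \<Rightarrow> real) \<Rightarrow> 'a \<Rightarrow> ('a set \<Rightarrow> nat) \<times> ('a set \<Rightarrow> nat) \<Rightarrow> 'a set" where
  "mdd_loop V w x = (\<lambda>(m1, m2).
     {y. (x, y) \<in> {(u, v). {u, v} \<in> edges V w \<and> m1 {u, v} + m2 {u, v} > 0}\<^sup>*})"

definition mdd_open_configs ::
    "'a set \<Rightarrow> ('a \<Rightarrow> 'a \<Rightarrow> real) \<Rightarrow> 'a \<Rightarrow> 'a \<Rightarrow> (('a set \<Rightarrow> nat) \<times> ('a set \<Rightarrow> nat)) set" where
  "mdd_open_configs V w x y =
     {(m1, m2) \<in> dimer_configs V w \<times> dimer_configs V w.
        (\<forall>z\<in>V - {x, y}. dimer_degree V w m1 z = dimer_degree V w m2 z \<and>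
                         dimer_degree V w m1 z \<in> {0, 1}) \<and>
        dimer_degree V w m1 x = 0 \<and> dimer_degree V w m1 y = 0 \<and>
        dimer_degree V w m2 x = 1 \<and> dimer_degree V w m2 y = 1}"

definition mdd_G :: "'a set \<Rightarrow> ('a \<Rightarrow> 'a \<Rightarrow> real) \<Rightarrow> 'a \<Rightarrow> 'a \<Rightarrow> real" where
  "mdd_G V w x y =
     (if x = y then 0
      else (\<Sum>m\<in>mdd_open_configs V w x y. mdd_weight V w (V - {x, y}) m) / mdd_Z V w)"


section \<open>Random lattice permutations\<close>

definition per_Z :: "'a set \<Rightarrow> ('a \<Rightarrow> 'a \<Rightarrow> real) \<Rightarrow> real" where
  "per_Z V w = (\<Sum>\<pi> | \<pi> permutes V. \<Prod>x\<in>V. w x (\<pi> x))"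

definition per_measure :: "'a set \<Rightarrow> ('a \<Rightarrow> 'a \<Rightarrow> real) \<Rightarrow> ('a \<Rightarrow> 'a) measure" where
  "per_measure V w =
     point_measure {\<pi>. \<pi> permutes V} (\<lambda>\<pi>. ennreal ((\<Prod>x\<in>V. w x (\<pi> x)) / per_Z V w))"

definition per_loop :: "'a \<Rightarrow> ('a \<Rightarrow> 'a) \<Rightarrow> 'a set" where
  "per_loop x \<pi> = {(\<pi> ^^ n) x | n. True}"

definition per_G :: "'a set \<Rightarrow> ('a \<Rightarrow> 'a \<Rightarrow> real) \<Rightarrow> 'a \<Rightarrow> 'a \<Rightarrow> real" where
  "per_G V w x y =
     (\<Sum>\<pi> | \<pi> \<in> extensional (V - {y}) \<and> bij_betw \<pi> (V - {y}) (V - {x}).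
        \<Prod>z\<in>V - {y}. w z (\<pi> z)) / per_Z V w"


section \<open>The torus\<close>

text \<open>\<open>(\<int>/L\<int>)\<^sup>d\<close> is represented by the residues in \<open>{0..<L}\<^sup>d\<close>; the dimension \<open>d \<ge> 1\<close> is the
  cardinality of the index type. The periodised weights and the torus norm are invariant
  under shifting arguments by \<open>L\<int>\<^sup>d\<close>, so they do not depend on this choice.\<close>

definition torus :: "nat \<Rightarrow> (int ^ 'd) set" where
  "torus L = {x. \<forall>i. 0 \<le> x $ i \<and> x $ i < int L}"

definition norm1 :: "int ^ 'd \<Rightarrow> real" where
  "norm1 x = real_of_int (\<Sum>i\<in>UNIV. \<bar>x $ i\<bar>)"

definition torus_norm1 :: "nat \<Rightarrow> int ^ 'd \<Rightarrow> real" where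
  "torus_norm1 L x = (INF z. norm1 (x + int L *s z))"

definition periodised :: "nat \<Rightarrow> (int ^ 'd \<Rightarrow> real) \<Rightarrow> int ^ 'd \<Rightarrow> int ^ 'd \<Rightarrow> real" where
  "periodised L w x y = (\<Sum>\<^sub>\<infinity>z. w (y - x + int L *s z))"

definition G_mdd :: "(int ^ 'd \<Rightarrow> real) \<Rightarrow> nat \<Rightarrow> int ^ 'd \<Rightarrow> real" where
  "G_mdd w L x = mdd_G (torus L) (periodised L w) 0 x"

definition G_per :: "(int ^ 'd \<Rightarrow> real) \<Rightarrow> nat \<Rightarrow> int ^ 'd \<Rightarrow> real" where
  "G_per w L x = per_G (torus L) (periodised L w) 0 x"

definition loop_prob_mdd :: "(int ^ 'd \<Rightarrow> real) \<Rightarrow> nat \<Rightarrow> int ^ 'd \<Rightarrow> real" where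
  "loop_prob_mdd w L x =
     measure (mdd_measure (torus L) (periodised L w))
       {m \<in> mdd_configs (torus L) (periodised L w).
          x \<in> mdd_loop (torus L) (periodised L w) 0 m}"

definition loop_prob_per :: "(int ^ 'd \<Rightarrow> real) \<Rightarrow> nat \<Rightarrow> int ^ 'd \<Rightarrow> real" where
  "loop_prob_per w L x =
     measure (per_measure (torus L) (periodised L w))
       {\<pi>. \<pi> permutes torus L \<and> x \<in> per_loop 0 \<pi>}"

end

theory Submission
  imports Defs
begin

text \<open>Write a configuration with an open path from \<open>x\<close> to \<open>z\<close> in \<open>V\<close> as its first step
  \<open>x \<rightarrow> u\<close> together with a configuration with an open path from \<open>u\<close> to \<open>z\<close> in \<open>V - {x}\<close>.
  Since adding the monomer (or fixed point) \<open>x\<close> gives \<open>w x x * Z (V - {x}) \<le> Z V\<close>, the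
  normalised sums satisfy \<open>G\<^sub>V(x,z) \<le> \<Sum>\<^sub>u w(x,u)/w(x,x) * G\<^sub>V\<^sub>-\<^sub>x(u,z)\<close>, the recursion of a
  random walk that is killed because \<open>w 0 > 1/2\<close>. Hence, for every weight \<open>\<psi>\<close> that is a
  supersolution of this recursion, induction on \<open>V\<close> bounds \<open>\<Sum>\<^sub>z \<psi>(z) G\<^sub>V(x,z)\<close> by a
  constant times \<open>\<psi>(x)\<close>, uniformly in \<open>V\<close>. Loops through \<open>x\<close> are opened by deleting their
  edge into \<open>x\<close>. On the torus, \<open>\<psi>(y) = \<Phi>(\<epsilon>|y|)\<close> is a supersolution for small \<open>\<epsilon>\<close> whenever
  \<open>\<Phi>\<close> is submultiplicative with \<open>\<Phi>(0) = 1\<close> and \<open>\<Sum> w(x) \<Phi>(|x|) < \<infinity>\<close>, and the three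
  claims are the choices \<open>min (exp r) K\<close>, \<open>(1 + r)\<^sup>p\<close> and \<open>exp (\<eta> r)\<close>.\<close>

section \<open>Path expansions\<close>

text \<open>Deleting vertices destroys translation invariance after a single step. The estimates are
  therefore stated for every subset \<open>V\<close> of a fixed \<open>T\<close>, under row-sum
  conditions on \<open>T\<close> that pass to subsets because all terms are nonnegative. The
  threshold 1/2 comes from the killing: one step carries off-diagonal mass at most
  \<open>1 - w 0\<close>, while a deleted vertex is worth at least \<open>w 0\<close> in the
  partition function, so the ratio is below one once \<open>w 0 > 1/2\<close>. The remaining slack
  pays for the tilt, whose row sums may grow to \<open>s = 1/2\<close> against
  \<open>a = w 0\<close>. In the double-dimer model, deletion leaves the class of configurations
  that defines the two-point function, since the next edge of the path lies in the other matching.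
  The two matchings are therefore exchanged after every step, and the far end may be covered by
  either of them. A loop probability needs the weight of all vertices along a path, not only of its
  end; this composes two killed walks, whence the square in
  \<open>a / (a - s)\<^sup>2\<close>.\<close>

lemma sum_le_sum_inj:
  fixes f :: "'a \<Rightarrow> real"
  assumes "inj_on h A" "h ` A \<subseteq> B" "finite B"
    and "\<And>a. a \<in> A \<Longrightarrow> f a \<le> g (h a)" "\<And>b. b \<in> B \<Longrightarrow> 0 \<le> g b"
  shows "sum f A \<le> sum g B"
proof -
  have "sum f A \<le> (\<Sum>a\<in>A. g (h a))"
    by (intro sum_mono assms)
  also have "\<dots> = sum g (h ` A)"
    using assms by (simp add: sum.reindex)
  also have "\<dots> \<le> sum g B"
    using assms by (intro sum_mono2) auto
  finally show ?thesis .
qed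

lemma sum_Sigma_iterated:
  assumes "finite A" "\<And>z. z \<in> A \<Longrightarrow> finite (B z)"
  shows "sum g (Sigma A B) = (\<Sum>z\<in>A. \<Sum>c\<in>B z. g (z, c))"
  using assms by (simp add: sum.Sigma)

text \<open>Cut the walk at its last visit to \<open>x\<close>; what follows never returns there.
  This is why reached vertices can still be tracked after \<open>x\<close> has been deleted.\<close>

lemma rtrancl_avoid_start:
  assumes "(x, y) \<in> R\<^sup>*" "y \<noteq> x"
  shows "\<exists>u. (x, u) \<in> R \<and> u \<noteq> x \<and> (u, y) \<in> {(a, b) \<in> R. a \<noteq> x \<and> b \<noteq> x}\<^sup>*"
  using assms
proof (induction rule: rtrancl_induct)
  case (step y z)
  then show ?case
    by (cases "y = x") (auto intro: rtrancl.rtrancl_into_rtrancl)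
qed simp

text \<open>\<open>paths V x z\<close> are the configurations on \<open>V\<close> with an open path from \<open>x\<close> to \<open>z\<close>; \<open>nxt\<close> is
  the first vertex after \<open>x\<close> on it, \<open>rest\<close> the configuration left after deleting \<open>x\<close>, and
  \<open>reach\<close> contains the vertices of the path.\<close>

locale path_expansion =
  fixes w :: "'a \<Rightarrow> 'a \<Rightarrow> real"
    and Z :: "'a set \<Rightarrow> real"
    and paths :: "'a set \<Rightarrow> 'a \<Rightarrow> 'a \<Rightarrow> 'c set"
    and wt :: "'a set \<Rightarrow> 'a \<Rightarrow> 'a \<Rightarrow> 'c \<Rightarrow> real"
    and reach :: "'a set \<Rightarrow> 'a \<Rightarrow> 'a \<Rightarrow> 'c \<Rightarrow> 'a set"
    and nxt :: "'a \<Rightarrow> 'c \<Rightarrow> 'a"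
    and rest :: "'a set \<Rightarrow> 'a \<Rightarrow> 'a \<Rightarrow> 'c \<Rightarrow> 'c"
  assumes w_nonneg: "0 \<le> w x y"
    and w_diag: "0 < w x x"
    and Z_empty: "0 < Z {}"
    and Z_remove: "finite V \<Longrightarrow> x \<in> V \<Longrightarrow> w x x * Z (V - {x}) \<le> Z V"
    and finite_paths: "finite V \<Longrightarrow> finite (paths V x z)"
    and wt_nonneg: "c \<in> paths V x z \<Longrightarrow> 0 \<le> wt V x z c"
    and wt_trivial: "finite V \<Longrightarrow> x \<in> V \<Longrightarrow> (\<Sum>c\<in>paths V x x. wt V x x c) \<le> Z (V - {x})"
    and reach_trivial: "c \<in> paths V x x \<Longrightarrow> reach V x x c \<subseteq> {x}"
    and nxt_in: "\<lbrakk>finite V; x \<in> V; z \<in> V; x \<noteq> z; c \<in> paths V x z\<rbrakk> \<Longrightarrow> nxt x c \<in> V - {x}"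
    and rest_in: "\<lbrakk>finite V; x \<in> V; z \<in> V; x \<noteq> z; c \<in> paths V x z\<rbrakk> \<Longrightarrow>
      rest V x z c \<in> paths (V - {x}) (nxt x c) z"
    and wt_step: "\<lbrakk>finite V; x \<in> V; z \<in> V; x \<noteq> z; c \<in> paths V x z\<rbrakk> \<Longrightarrow>
      wt V x z c = w x (nxt x c) * wt (V - {x}) (nxt x c) z (rest V x z c)"
    and inj_step: "\<lbrakk>finite V; x \<in> V; z \<in> V; x \<noteq> z\<rbrakk> \<Longrightarrow>
      inj_on (\<lambda>c. (nxt x c, rest V x z c)) (paths V x z)"
    and reach_step: "\<lbrakk>finite V; x \<in> V; z \<in> V; x \<noteq> z; c \<in> paths V x z\<rbrakk> \<Longrightarrow>
      reach V x z c \<subseteq> insert x (reach (V - {x}) (nxt x c) z (rest V x z c))"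
begin

section \<open>One-step inequalities and weighted bounds for path sums\<close>

definition path_sum :: "'a set \<Rightarrow> 'a \<Rightarrow> 'a \<Rightarrow> real" where
  "path_sum V x z = (\<Sum>c\<in>paths V x z. wt V x z c)"

definition reach_sum :: "('a \<Rightarrow> real) \<Rightarrow> 'a set \<Rightarrow> 'a \<Rightarrow> 'a \<Rightarrow> real" where
  "reach_sum \<psi> V x z = (\<Sum>c\<in>paths V x z. wt V x z c * (\<Sum>y\<in>V \<inter> reach V x z c. \<psi> y))"

lemma Z_pos: "finite V \<Longrightarrow> 0 < Z V"
proof (induction V rule: finite_induct)
  case (insert x V)
  then have "0 < w x x * Z (insert x V - {x})"
    using w_diag by simp
  also have "\<dots> \<le> Z (insert x V)"
    using insert by (intro Z_remove) auto
  finally show ?case .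
qed (rule Z_empty)

text \<open>Each configuration is charged to its first step and its remainder, which determine it.
  The choice \<open>f = 1\<close> yields the recursion for path sums; the weight of the reached
  vertices other than \<open>x\<close> yields the one for reach sums.\<close>

lemma sum_paths_step:
  assumes V: "finite V" "x \<in> V" "z \<in> V" "x \<noteq> z"
    and fg: "\<And>c. c \<in> paths V x z \<Longrightarrow> f c \<le> g (nxt x c) (rest V x z c)"
    and g: "\<And>u c. 0 \<le> g u c"
  shows "(\<Sum>c\<in>paths V x z. wt V x z c * f c)
    \<le> (\<Sum>u\<in>V - {x}. w x u * (\<Sum>c\<in>paths (V - {x}) u z. wt (V - {x}) u z c * g u c))"
proof -
  let ?S = "Sigma (V - {x}) (\<lambda>u. paths (V - {x}) u z)"
  let ?h = "\<lambda>(u, c). w x u * (wt (V - {x}) u z c * g u c)"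
  let ?s = "\<lambda>c. (nxt x c, rest V x z c)"
  have "(\<Sum>c\<in>paths V x z. wt V x z c * f c) \<le> sum ?h ?S"
  proof (rule sum_le_sum_inj[OF inj_step[OF V]])
    fix c assume c: "c \<in> paths V x z"
    have "wt V x z c * f c \<le> wt V x z c * g (nxt x c) (rest V x z c)"
      by (intro mult_left_mono fg wt_nonneg c)
    also have "\<dots> = ?h (?s c)"
      by (simp add: wt_step[OF V c])
    finally show "wt V x z c * f c \<le> ?h (?s c)" .
  next
    show "finite ?S"
      using V by (auto intro!: finite_SigmaI finite_paths)
    show "?s ` paths V x z \<subseteq> ?S"
      using nxt_in[OF V] rest_in[OF V] by auto
  qed (auto intro!: mult_nonneg_nonneg w_nonneg wt_nonneg g)
  also have "\<dots> = (\<Sum>u\<in>V - {x}. w x u * (\<Sum>c\<in>paths (V - {x}) u z. wt (V - {x}) u z c * g u c))"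
    using V by (subst sum.Sigma[symmetric]) (auto simp: finite_paths sum_distrib_left)
  finally show ?thesis .
qed

lemma path_sum_step:
  assumes "finite V" "x \<in> V" "z \<in> V" "x \<noteq> z"
  shows "path_sum V x z \<le> (\<Sum>u\<in>V - {x}. w x u * path_sum (V - {x}) u z)"
  using sum_paths_step[OF assms, of "\<lambda>_. 1" "\<lambda>_ _. 1"] by (simp add: path_sum_def)

text \<open>Every path contributes \<open>\<psi> x\<close> for its start, which gives the first
  term. All other reached vertices are already reached by the remainder of the path.\<close>

lemma reach_sum_step:
  assumes V: "finite V" "x \<in> V" "z \<in> V" "x \<noteq> z" and \<psi>: "\<And>y. 0 \<le> \<psi> y"
  shows "reach_sum \<psi> V x z
    \<le> \<psi> x * path_sum V x z + (\<Sum>u\<in>V - {x}. w x u * reach_sum \<psi> (V - {x}) u z)"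
proof -
  let ?f = "\<lambda>c. \<Sum>y\<in>(V - {x}) \<inter> reach V x z c. \<psi> y"
  let ?g = "\<lambda>u c. \<Sum>y\<in>(V - {x}) \<inter> reach (V - {x}) u z c. \<psi> y"
  have "reach_sum \<psi> V x z \<le> (\<Sum>c\<in>paths V x z. \<psi> x * wt V x z c + wt V x z c * ?f c)"
    unfolding reach_sum_def
  proof (rule sum_mono)
    fix c assume c: "c \<in> paths V x z"
    have "(\<Sum>y\<in>V \<inter> reach V x z c. \<psi> y) \<le> (\<Sum>y\<in>insert x ((V - {x}) \<inter> reach V x z c). \<psi> y)"
      using V \<psi> by (intro sum_mono2) auto
    also have "\<dots> = \<psi> x + ?f c"
      using V by simp
    finally have "wt V x z c * (\<Sum>y\<in>V \<inter> reach V x z c. \<psi> y) \<le> wt V x z c * (\<psi> x + ?f c)"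
      by (intro mult_left_mono wt_nonneg c)
    then show "wt V x z c * (\<Sum>y\<in>V \<inter> reach V x z c. \<psi> y)
      \<le> \<psi> x * wt V x z c + wt V x z c * ?f c"
      by (simp add: algebra_simps)
  qed
  also have "\<dots> = \<psi> x * path_sum V x z + (\<Sum>c\<in>paths V x z. wt V x z c * ?f c)"
    by (simp add: path_sum_def sum.distrib sum_distrib_left)
  also have "(\<Sum>c\<in>paths V x z. wt V x z c * ?f c)
      \<le> (\<Sum>u\<in>V - {x}. w x u * (\<Sum>c\<in>paths (V - {x}) u z. wt (V - {x}) u z c * ?g u c))"
  proof (rule sum_paths_step[OF V])
    fix c assume "c \<in> paths V x z"
    from reach_step[OF V this] show "?f c \<le> ?g (nxt x c) (rest V x z c)"
      using V \<psi> by (intro sum_mono2) auto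
  qed (use \<psi> in \<open>auto intro: sum_nonneg\<close>)
  finally show ?thesis
    by (simp add: reach_sum_def)
qed

lemma reach_sum_trivial:
  assumes "finite V" "\<And>y. 0 \<le> \<psi> y"
  shows "reach_sum \<psi> V x x \<le> \<psi> x * path_sum V x x"
proof -
  have "reach_sum \<psi> V x x \<le> (\<Sum>c\<in>paths V x x. \<psi> x * wt V x x c)"
    unfolding reach_sum_def
  proof (rule sum_mono)
    fix c assume c: "c \<in> paths V x x"
    then have "(\<Sum>y\<in>V \<inter> reach V x x c. \<psi> y) \<le> (\<Sum>y\<in>{x}. \<psi> y)"
      using reach_trivial assms by (intro sum_mono2) auto
    then have "wt V x x c * (\<Sum>y\<in>V \<inter> reach V x x c. \<psi> y) \<le> wt V x x c * \<psi> x"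
      by (intro mult_left_mono wt_nonneg c) simp
    then show "wt V x x c * (\<Sum>y\<in>V \<inter> reach V x x c. \<psi> y) \<le> \<psi> x * wt V x x c"
      by (simp add: mult.commute)
  qed
  then show ?thesis
    by (simp add: path_sum_def sum_distrib_left)
qed

lemma path_sum_nonneg: "0 \<le> path_sum V x z"
  by (simp add: path_sum_def sum_nonneg wt_nonneg)

lemma reach_sum_nonneg:
  assumes "\<And>y. 0 \<le> \<psi> y"
  shows "0 \<le> reach_sum \<psi> V x z"
  using assms by (auto simp: reach_sum_def intro!: sum_nonneg mult_nonneg_nonneg wt_nonneg)

text \<open>The trivial path contributes at most \<open>\<psi> x * Z (V - {x})\<close>, and the
  induction hypothesis bounds all longer paths by \<open>s / (a - s)\<close> times the same
  quantity. Since \<open>1 + s / (a - s) = a / (a - s)\<close>, the sum carries exactly the factor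
  \<open>a\<close> that turns \<open>Z (V - {x})\<close> into \<open>Z V\<close>. The set
  \<open>V\<close> shrinks in the induction while \<open>T\<close>, on which the hypotheses are
  stated, stays fixed.\<close>

lemma sum_path_sum_le:
  assumes "finite T" and V: "V \<subseteq> T" "x \<in> V"
    and diag: "\<And>x. x \<in> T \<Longrightarrow> a \<le> w x x"
    and off: "\<And>x. x \<in> T \<Longrightarrow> (\<Sum>u\<in>T - {x}. w x u * \<psi> u) \<le> s * \<psi> x"
    and \<psi>: "\<And>y. 0 \<le> \<psi> y" and as: "0 \<le> s" "s < a"
  shows "(\<Sum>z\<in>V. \<psi> z * path_sum V x z) \<le> Z V * \<psi> x / (a - s)"
proof -
  have "finite V" using V \<open>finite T\<close> finite_subset by blast
  then show ?thesis using V
  proof (induction V arbitrary: x rule: finite_psubset_induct)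
    case (psubset V)
    let ?V = "V - {x}"
    have x: "x \<in> T" and fin: "finite ?V" using psubset by auto
    have Z': "0 < Z ?V" using fin by (rule Z_pos)
    have "(\<Sum>z\<in>V. \<psi> z * path_sum V x z)
        = \<psi> x * path_sum V x x + (\<Sum>z\<in>?V. \<psi> z * path_sum V x z)"
      using psubset by (simp add: sum.remove)
    also have "\<dots> \<le> \<psi> x * Z ?V + (\<Sum>z\<in>?V. \<psi> z * (\<Sum>u\<in>?V. w x u * path_sum ?V u z))"
      using psubset \<psi> wt_trivial[of V x] path_sum_step[of V x]
      by (intro add_mono mult_left_mono sum_mono) (auto simp: path_sum_def)
    also have "(\<Sum>z\<in>?V. \<psi> z * (\<Sum>u\<in>?V. w x u * path_sum ?V u z))
        = (\<Sum>u\<in>?V. w x u * (\<Sum>z\<in>?V. \<psi> z * path_sum ?V u z))"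
      unfolding sum_distrib_left by (subst sum.swap) (simp add: mult_ac)
    also have "\<dots> \<le> (\<Sum>u\<in>?V. w x u * (Z ?V * \<psi> u / (a - s)))"
      using psubset by (intro sum_mono mult_left_mono w_nonneg psubset.IH) auto
    also have "\<dots> = Z ?V / (a - s) * (\<Sum>u\<in>?V. w x u * \<psi> u)"
      by (simp add: sum_distrib_left mult_ac)
    also have "(\<Sum>u\<in>?V. w x u * \<psi> u) \<le> (\<Sum>u\<in>T - {x}. w x u * \<psi> u)"
      using psubset \<open>finite T\<close> \<psi> by (intro sum_mono2) (auto simp: w_nonneg)
    also have "\<dots> \<le> s * \<psi> x" by (rule off[OF x])
    finally have "(\<Sum>z\<in>V. \<psi> z * path_sum V x z) \<le> \<psi> x * Z ?V + Z ?V / (a - s) * (s * \<psi> x)"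
      using Z' as by (simp add: mult_left_mono divide_right_mono)
    also have "\<dots> = a * Z ?V * (\<psi> x / (a - s))"
      using as by (simp add: field_simps)
    also have "a * Z ?V \<le> w x x * Z ?V"
      using diag[OF x] Z' by (intro mult_right_mono) auto
    also have "\<dots> \<le> Z V"
      using psubset by (intro Z_remove) auto
    finally show ?case
      using as \<psi>[of x] by (simp add: mult_right_mono divide_right_mono)
  qed
qed

text \<open>The start of the path costs \<open>\<psi> x\<close> times the total path sum, at most
  \<open>Z V / (a - s)\<close>; the remainder costs the induction constant times
  \<open>s / a\<close>. The constant is thus the solution of
  \<open>C = 1 / (a - s) + C * s / a\<close>, namely \<open>a / (a - s)\<^sup>2\<close>.\<close>

lemma sum_reach_sum_le:
  assumes "finite T" and V: "V \<subseteq> T" "x \<in> V"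
    and diag: "\<And>x. x \<in> T \<Longrightarrow> a \<le> w x x"
    and off1: "\<And>x. x \<in> T \<Longrightarrow> (\<Sum>u\<in>T - {x}. w x u) \<le> s"
    and off: "\<And>x. x \<in> T \<Longrightarrow> (\<Sum>u\<in>T - {x}. w x u * \<psi> u) \<le> s * \<psi> x"
    and \<psi>: "\<And>y. 0 \<le> \<psi> y" and as: "0 \<le> s" "s < a"
  shows "(\<Sum>z\<in>V. reach_sum \<psi> V x z) \<le> Z V * \<psi> x * (a / (a - s)\<^sup>2)"
proof -
  have "finite V" using V \<open>finite T\<close> finite_subset by blast
  then show ?thesis using V
  proof (induction V arbitrary: x rule: finite_psubset_induct)
    case (psubset V)
    let ?V = "V - {x}"
    define C where "C = a / (a - s)\<^sup>2"
    have x: "x \<in> T" and fin: "finite ?V" using psubset by auto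
    have Z': "0 < Z ?V" using fin by (rule Z_pos)
    have C: "0 \<le> C" using as by (simp add: C_def)
    have "(\<Sum>z\<in>V. reach_sum \<psi> V x z) = reach_sum \<psi> V x x + (\<Sum>z\<in>?V. reach_sum \<psi> V x z)"
      using psubset by (simp add: sum.remove)
    also have "\<dots> \<le> \<psi> x * path_sum V x x
        + (\<Sum>z\<in>?V. \<psi> x * path_sum V x z + (\<Sum>u\<in>?V. w x u * reach_sum \<psi> ?V u z))"
      using psubset \<psi> reach_sum_trivial[of V \<psi> x] reach_sum_step[of V x _ \<psi>]
      by (intro add_mono sum_mono) auto
    also have "\<dots> = \<psi> x * (\<Sum>z\<in>V. path_sum V x z)
        + (\<Sum>z\<in>?V. \<Sum>u\<in>?V. w x u * reach_sum \<psi> ?V u z)"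
      using psubset by (simp add: sum.remove[of V x] sum.distrib sum_distrib_left distrib_left)
    also have "(\<Sum>z\<in>?V. \<Sum>u\<in>?V. w x u * reach_sum \<psi> ?V u z)
        = (\<Sum>u\<in>?V. w x u * (\<Sum>z\<in>?V. reach_sum \<psi> ?V u z))"
      unfolding sum_distrib_left by (rule sum.swap)
    also have "\<dots> \<le> (\<Sum>u\<in>?V. w x u * (Z ?V * \<psi> u * C))"
      using psubset by (intro sum_mono mult_left_mono w_nonneg psubset.IH[folded C_def]) auto
    also have "\<dots> = Z ?V * C * (\<Sum>u\<in>?V. w x u * \<psi> u)"
      by (simp add: sum_distrib_left mult_ac)
    also have "(\<Sum>u\<in>?V. w x u * \<psi> u) \<le> (\<Sum>u\<in>T - {x}. w x u * \<psi> u)"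
      using psubset \<open>finite T\<close> \<psi> by (intro sum_mono2) (auto simp: w_nonneg)
    also have "\<dots> \<le> s * \<psi> x" by (rule off[OF x])
    \<comment> \<open>The untilted case, with the constant function 1 as supersolution; this is
      where \<open>off1\<close> enters.\<close>
    also have "(\<Sum>z\<in>V. path_sum V x z) \<le> Z V / (a - s)"
      using sum_path_sum_le[of T V x a "\<lambda>_. 1" s] assms(1) psubset diag off1 as by simp
    finally have "(\<Sum>z\<in>V. reach_sum \<psi> V x z)
        \<le> \<psi> x * (Z V / (a - s)) + Z ?V * C * (s * \<psi> x)"
      using Z' C \<psi>[of x] by (simp add: mult_left_mono)
    also have "\<dots> = \<psi> x * (Z V / (a - s)) + a * Z ?V * (s * \<psi> x / (a - s)\<^sup>2)"
      by (simp add: C_def)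
    also have "a * Z ?V \<le> w x x * Z ?V"
      using diag[OF x] Z' by (intro mult_right_mono) auto
    also have "\<dots> \<le> Z V"
      using psubset by (intro Z_remove) auto
    finally have "(\<Sum>z\<in>V. reach_sum \<psi> V x z)
        \<le> \<psi> x * (Z V / (a - s)) + Z V * (s * \<psi> x / (a - s)\<^sup>2)"
      using as \<psi>[of x] by (simp add: mult_right_mono divide_right_mono)
    also have "\<dots> = Z V * \<psi> x * ((a - s) / (a - s)\<^sup>2 + s / (a - s)\<^sup>2)"
      using as by (simp add: power2_eq_square distrib_left mult_ac)
    also have "\<dots> = Z V * \<psi> x * C"
      by (simp add: C_def add_divide_distrib[symmetric])
    finally show ?case by (simp add: C_def)
  qed
qed

end

section \<open>Permutations\<close>

text \<open>These are the maps summed over in \<open>per_G V w x z\<close>. The vertex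
  \<open>x\<close> has no preimage and \<open>z\<close> no image, so the orbit of \<open>x\<close>
  is a path ending at \<open>z\<close>; for \<open>x = z\<close> such a map permutes
  \<open>V - {x}\<close>.\<close>

definition open_perms :: "'a set \<Rightarrow> 'a \<Rightarrow> 'a \<Rightarrow> ('a \<Rightarrow> 'a) set" where
  "open_perms V x z = {\<pi>. \<pi> \<in> extensional (V - {z}) \<and> bij_betw \<pi> (V - {z}) (V - {x})}"

definition open_perm_weight ::
    "('a \<Rightarrow> 'a \<Rightarrow> real) \<Rightarrow> 'a set \<Rightarrow> 'a \<Rightarrow> 'a \<Rightarrow> ('a \<Rightarrow> 'a) \<Rightarrow> real" where
  "open_perm_weight w V x z \<pi> = (\<Prod>v\<in>V - {z}. w v (\<pi> v))"

definition open_perm_reach :: "'a set \<Rightarrow> 'a \<Rightarrow> 'a \<Rightarrow> ('a \<Rightarrow> 'a) \<Rightarrow> 'a set" where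
  "open_perm_reach V x z \<pi> = {y. (x, y) \<in> {(v, \<pi> v) | v. v \<in> V - {z}}\<^sup>*}"

lemma finite_open_perms:
  assumes "finite V"
  shows "finite (open_perms V x z)"
proof (rule finite_subset)
  show "open_perms V x z \<subseteq> (V - {z}) \<rightarrow>\<^sub>E (V - {x})"
    by (auto simp: open_perms_def PiE_def bij_betw_def)
  show "finite ((V - {z}) \<rightarrow>\<^sub>E (V - {x}))"
    using assms by (intro finite_PiE) auto
qed

lemma per_Z_remove:
  assumes "finite V" "x \<in> V" and w: "\<And>x y. 0 \<le> w x y"
  shows "w x x * per_Z (V - {x}) w \<le> per_Z V w"
proof -
  have "w x x * (\<Prod>v\<in>V - {x}. w v (\<pi> v)) = (\<Prod>v\<in>V. w v (\<pi> v))"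
    if "\<pi> permutes (V - {x})" for \<pi>
    using assms permutes_not_in[OF that, of x] by (simp add: prod.remove)
  then have "w x x * per_Z (V - {x}) w
      = (\<Sum>\<pi> | \<pi> permutes (V - {x}). \<Prod>v\<in>V. w v (\<pi> v))"
    by (simp add: per_Z_def sum_distrib_left)
  also have "\<dots> \<le> per_Z V w"
    unfolding per_Z_def using assms
    by (intro sum_mono2 finite_permutations)
       (auto intro: permutes_subset prod_nonneg)
  finally show ?thesis .
qed

text \<open>Equal end points leave a permutation of \<open>V - {x}\<close>; only the convention
  outside this set differs, \<open>undefined\<close> here and the identity for
  \<open>permutes\<close>.\<close>

lemma sum_open_perms_trivial:
  assumes "finite V" and w: "\<And>x y. 0 \<le> w x y"
  shows "(\<Sum>\<pi>\<in>open_perms V x x. open_perm_weight w V x x \<pi>) \<le> per_Z (V - {x}) w"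
  unfolding per_Z_def
proof (rule sum_le_sum_inj)
  let ?h = "\<lambda>\<pi> v. if v \<in> V - {x} then \<pi> v else v"
  show "inj_on ?h (open_perms V x x)"
  proof (rule inj_onI)
    fix \<pi> \<pi>' assume *: "\<pi> \<in> open_perms V x x" "\<pi>' \<in> open_perms V x x" "?h \<pi> = ?h \<pi>'"
    show "\<pi> = \<pi>'"
    proof (rule extensionalityI)
      show "\<pi> v = \<pi>' v" if "v \<in> V - {x}" for v
        using fun_cong[OF *(3), of v] that by simp
    qed (use * in \<open>auto simp: open_perms_def\<close>)
  qed
  show "?h ` open_perms V x x \<subseteq> {\<pi>. \<pi> permutes V - {x}}"
  proof safe
    fix \<pi> assume "\<pi> \<in> open_perms V x x"
    then have "bij_betw (?h \<pi>) (V - {x}) (V - {x})"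
      by (subst bij_betw_cong[where g = \<pi>]) (auto simp: open_perms_def)
    then show "?h \<pi> permutes V - {x}"
      by (rule bij_imp_permutes) auto
  qed
qed (use assms in \<open>auto simp: finite_permutations open_perm_weight_def intro: prod_nonneg\<close>)

lemma open_perms_inj_step:
  assumes "x \<in> V" "x \<noteq> z"
  shows "inj_on (\<lambda>\<pi>. (\<pi> x, restrict \<pi> (V - {x} - {z}))) (open_perms V x z)"
proof (rule inj_onI)
  fix \<pi> \<pi>' assume *: "\<pi> \<in> open_perms V x z" "\<pi>' \<in> open_perms V x z"
    "(\<pi> x, restrict \<pi> (V - {x} - {z})) = (\<pi>' x, restrict \<pi>' (V - {x} - {z}))"
  show "\<pi> = \<pi>'"
  proof (rule extensionalityI)
    show "\<pi> v = \<pi>' v" if "v \<in> V - {z}" for v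
    proof (cases "v = x")
      case False
      have "restrict \<pi> (V - {x} - {z}) v = restrict \<pi>' (V - {x} - {z}) v"
        using *(3) by simp
      then show ?thesis
        using False that by simp
    qed (use * in simp)
  qed (use * in \<open>auto simp: open_perms_def\<close>)
qed

text \<open>Once \<open>x\<close> has left the domain, \<open>\<pi> x\<close> is the vertex without
  a preimage and hence the new start. If \<open>\<pi> x = z\<close>, the remaining path is
  trivial.\<close>

lemma restrict_open_perms:
  assumes "x \<in> V" "x \<noteq> z" "\<pi> \<in> open_perms V x z"
  shows "restrict \<pi> (V - {x} - {z}) \<in> open_perms (V - {x}) (\<pi> x) z"
proof -
  have \<pi>: "inj_on \<pi> (V - {z})" "\<pi> ` (V - {z}) = V - {x}"
    using assms by (auto simp: open_perms_def bij_betw_def)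
  have "\<pi> ` (V - {z} - {x}) = V - {x} - {\<pi> x}"
    using \<pi> assms by (subst inj_on_image_set_diff[OF \<pi>(1)]) auto
  then have "bij_betw \<pi> (V - {z} - {x}) (V - {x} - {\<pi> x})"
    using \<pi> by (auto simp: bij_betw_def intro: inj_on_subset)
  moreover have "V - {z} - {x} = V - {x} - {z}"
    by auto
  ultimately have "bij_betw \<pi> (V - {x} - {z}) (V - {x} - {\<pi> x})"
    by simp
  then have "bij_betw (restrict \<pi> (V - {x} - {z})) (V - {x} - {z}) (V - {x} - {\<pi> x})"
    by (subst bij_betw_cong[where g = \<pi>]) auto
  then show ?thesis
    by (simp add: open_perms_def)
qed

lemma open_perm_reach_step:
  assumes "x \<in> V" "x \<noteq> z" "\<pi> \<in> open_perms V x z"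
  shows "open_perm_reach V x z \<pi>
    \<subseteq> insert x (open_perm_reach (V - {x}) (\<pi> x) z (restrict \<pi> (V - {x} - {z})))"
proof
  fix y assume y: "y \<in> open_perm_reach V x z \<pi>"
  let ?R = "{(v, \<pi> v) | v. v \<in> V - {z}}"
  let ?\<pi> = "restrict \<pi> (V - {x} - {z})"
  let ?R' = "{(v, ?\<pi> v) | v. v \<in> V - {x} - {z}}"
  show "y \<in> insert x (open_perm_reach (V - {x}) (\<pi> x) z ?\<pi>)"
  proof (cases "y = x")
    case False
    then obtain u where u: "(x, u) \<in> ?R" "(u, y) \<in> {(a, b) \<in> ?R. a \<noteq> x \<and> b \<noteq> x}\<^sup>*"
      using rtrancl_avoid_start[of x y ?R] y by (auto simp: open_perm_reach_def)
    have "{(a, b) \<in> ?R. a \<noteq> x \<and> b \<noteq> x} \<subseteq> ?R'"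
      by auto
    from subsetD[OF rtrancl_mono[OF this] u(2)] have "(\<pi> x, y) \<in> ?R'\<^sup>*"
      using u(1) by auto
    then show ?thesis by (subst open_perm_reach_def) blast
  qed simp
qed

lemma path_expansion_per:
  fixes w :: "'a \<Rightarrow> 'a \<Rightarrow> real"
  assumes w: "\<And>x y. 0 \<le> w x y" "\<And>x. 0 < w x x"
  shows "path_expansion w (\<lambda>V. per_Z V w) open_perms (open_perm_weight w) open_perm_reach
    (\<lambda>x \<pi>. \<pi> x) (\<lambda>V x z \<pi>. restrict \<pi> (V - {x} - {z}))"
proof
  fix V :: "'a set" and x z \<pi>
  show "open_perm_reach V x x \<pi> \<subseteq> {x}"
  proof
    fix y assume "y \<in> open_perm_reach V x x \<pi>"
    then have "(x, y) \<in> {(v, \<pi> v) | v. v \<in> V - {x}}\<^sup>*"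
      by (simp add: open_perm_reach_def)
    then show "y \<in> {x}"
      by (cases rule: converse_rtranclE) auto
  qed
  assume V: "finite V"
  assume xz: "x \<in> V" "z \<in> V" "x \<noteq> z"
  assume \<pi>: "\<pi> \<in> open_perms V x z"
  show "\<pi> x \<in> V - {x}"
    using \<pi> xz by (auto simp: open_perms_def bij_betw_def)
  have "open_perm_weight w V x z \<pi> = w x (\<pi> x) * (\<Prod>v\<in>V - {z} - {x}. w v (\<pi> v))"
    unfolding open_perm_weight_def using V xz by (intro prod.remove) auto
  also have "(\<Prod>v\<in>V - {z} - {x}. w v (\<pi> v))
      = (\<Prod>v\<in>V - {x} - {z}. w v (restrict \<pi> (V - {x} - {z}) v))"
    by (intro prod.cong) auto
  finally show "open_perm_weight w V x z \<pi>
    = w x (\<pi> x) * open_perm_weight w (V - {x}) (\<pi> x) z (restrict \<pi> (V - {x} - {z}))"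
    by (simp add: open_perm_weight_def)
next
  fix V :: "'a set" and x
  assume "finite V"
  then show "(\<Sum>\<pi>\<in>open_perms V x x. open_perm_weight w V x x \<pi>) \<le> per_Z (V - {x}) w"
    using w(1) by (rule sum_open_perms_trivial)
next
  fix V :: "'a set" and x z \<pi>
  assume "x \<in> V" "x \<noteq> z" "\<pi> \<in> open_perms V x z"
  then show "open_perm_reach V x z \<pi>
      \<subseteq> insert x (open_perm_reach (V - {x}) (\<pi> x) z (restrict \<pi> (V - {x} - {z})))"
    by (rule open_perm_reach_step)
qed (use w in \<open>simp_all add: per_Z_def[of "{}"] per_Z_remove finite_open_perms
       open_perms_inj_step restrict_open_perms open_perm_weight_def prod_nonneg\<close>)


section \<open>Opening the cycle of a permutation\<close>

lemma sum_measure_point_measure: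
  fixes f \<psi> :: "_ \<Rightarrow> real"
  assumes A: "finite A" "\<And>c. c \<in> A \<Longrightarrow> 0 \<le> f c" and V: "finite V"
  shows "(\<Sum>y\<in>V. \<psi> y * measure (point_measure A (\<lambda>c. ennreal (f c))) {c \<in> A. y \<in> L c})
    = (\<Sum>c\<in>A. f c * (\<Sum>y\<in>V \<inter> L c. \<psi> y))"
proof -
  have "measure (point_measure A (\<lambda>c. ennreal (f c))) {c \<in> A. y \<in> L c}
      = (\<Sum>c\<in>A. if y \<in> L c then f c else 0)" for y
    using A by (subst measure_point_measure_finite_if) (auto simp: sum.inter_filter)
  then have "(\<Sum>y\<in>V. \<psi> y * measure (point_measure A (\<lambda>c. ennreal (f c))) {c \<in> A. y \<in> L c})
      = (\<Sum>y\<in>V. \<Sum>c\<in>A. if y \<in> L c then f c * \<psi> y else 0)"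
    by (auto simp: sum_distrib_left intro!: sum.cong)
  also have "\<dots> = (\<Sum>c\<in>A. \<Sum>y\<in>V. if y \<in> L c then f c * \<psi> y else 0)"
    by (rule sum.swap)
  also have "\<dots> = (\<Sum>c\<in>A. f c * (\<Sum>y\<in>V \<inter> L c. \<psi> y))"
    using V by (simp add: sum.inter_restrict sum_distrib_left if_distrib[of "\<lambda>x. _ * x"] cong: if_cong)
  finally show ?thesis .
qed

text \<open>After its last visit to \<open>x\<close> the orbit never enters \<open>x\<close> again,
  so it does not use the step from \<open>z = inv \<pi> x\<close> into \<open>x\<close>, which is
  the only one removed by the restriction.\<close>

lemma per_loop_reach:
  assumes \<pi>: "\<pi> permutes V" and x: "x \<in> V" and y: "y \<in> per_loop x \<pi>" "y \<noteq> x"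
  defines "z \<equiv> inv \<pi> x"
  shows "y \<in> open_perm_reach V x z (restrict \<pi> (V - {z}))"
proof -
  let ?R = "{(v, \<pi> v) | v. v \<in> V}" and ?\<pi> = "restrict \<pi> (V - {z})"
  have "((\<pi> ^^ n) x \<in> V \<and> (x, (\<pi> ^^ n) x) \<in> ?R\<^sup>*)" for n
    by (induction n)
       (use x \<pi> in \<open>auto simp: permutes_in_image intro: rtrancl.rtrancl_into_rtrancl\<close>)
  then have "(x, y) \<in> ?R\<^sup>*"
    using y by (auto simp: per_loop_def)
  from rtrancl_avoid_start[OF this y(2)] obtain u
    where u: "(x, u) \<in> ?R" "u \<noteq> x" "(u, y) \<in> {(a, b) \<in> ?R. a \<noteq> x \<and> b \<noteq> x}\<^sup>*"
    by blast
  have z: "\<pi> z = x"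
    using \<pi> by (simp add: z_def permutes_inverses)
  have "{(a, b) \<in> ?R. a \<noteq> x \<and> b \<noteq> x} \<subseteq> {(v, ?\<pi> v) | v. v \<in> V - {z}}"
    using z by auto
  from subsetD[OF rtrancl_mono[OF this] u(3)]
  have "(u, y) \<in> {(v, ?\<pi> v) | v. v \<in> V - {z}}\<^sup>*" .
  moreover have "(x, u) \<in> {(v, ?\<pi> v) | v. v \<in> V - {z}}"
    using u z x by auto
  ultimately have "(x, y) \<in> {(v, ?\<pi> v) | v. v \<in> V - {z}}\<^sup>*"
    by (rule converse_rtrancl_into_rtrancl[rotated])
  then show ?thesis
    by (simp only: open_perm_reach_def mem_Collect_eq)
qed

lemma restrict_permutes_open_perms:
  assumes "\<pi> permutes V" "x \<in> V"
  shows "restrict \<pi> (V - {inv \<pi> x}) \<in> open_perms V x (inv \<pi> x)"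
proof -
  have x: "\<pi> (inv \<pi> x) = x" "inv \<pi> x \<in> V"
    using assms by (auto simp: permutes_inverses permutes_in_image permutes_inv)
  have inj: "inj_on \<pi> V"
    using assms permutes_inj_on by blast
  have "\<pi> ` (V - {inv \<pi> x}) = V - {x}"
    using assms x inj by (subst inj_on_image_set_diff[OF inj]) (auto simp: permutes_image)
  then have "bij_betw \<pi> (V - {inv \<pi> x}) (V - {x})"
    using inj by (auto simp: bij_betw_def intro: inj_on_subset)
  then have "bij_betw (restrict \<pi> (V - {inv \<pi> x})) (V - {inv \<pi> x}) (V - {x})"
    by (subst bij_betw_cong[where g = \<pi>]) auto
  then show ?thesis
    by (simp add: open_perms_def)
qed

text \<open>The first term accounts for \<open>x\<close> itself, and for a fixed point nothing else
  is in the cycle. Otherwise the step from \<open>z = inv \<pi> x\<close> into \<open>x\<close> is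
  removed: the weight loses the factor \<open>w z x\<close>, and nothing is forgotten, because the
  removed value is known to be \<open>x\<close>.\<close>

lemma sum_per_loop_le:
  fixes w :: "'a \<Rightarrow> 'a \<Rightarrow> real"
  assumes V: "finite V" "x \<in> V" and w: "\<And>x y. 0 \<le> w x y" and \<psi>: "\<And>y. 0 \<le> \<psi> y"
  shows "(\<Sum>\<pi> | \<pi> permutes V. (\<Prod>v\<in>V. w v (\<pi> v)) * (\<Sum>y\<in>V \<inter> per_loop x \<pi>. \<psi> y))
    \<le> per_Z V w * \<psi> x + (\<Sum>z\<in>V - {x}. w z x *
        (\<Sum>\<pi>\<in>open_perms V x z. open_perm_weight w V x z \<pi> *
          (\<Sum>y\<in>V \<inter> open_perm_reach V x z \<pi>. \<psi> y)))"
proof -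
  let ?P = "{\<pi>. \<pi> permutes V}" and ?Q = "{\<pi>. \<pi> permutes V \<and> \<pi> x \<noteq> x}"
  let ?wt = "\<lambda>\<pi>. \<Prod>v\<in>V. w v (\<pi> v)"
  let ?L = "\<lambda>\<pi>. \<Sum>y\<in>V \<inter> per_loop x \<pi> - {x}. \<psi> y"
  let ?S = "Sigma (V - {x}) (open_perms V x)"
  let ?g = "\<lambda>(z, \<pi>). w z x * (open_perm_weight w V x z \<pi> *
          (\<Sum>y\<in>V \<inter> open_perm_reach V x z \<pi>. \<psi> y))"
  let ?h = "\<lambda>\<pi>. (inv \<pi> x, restrict \<pi> (V - {inv \<pi> x}))"
  have fin: "finite ?P" "finite ?Q"
    using V by (auto intro: finite_subset[OF _ finite_permutations[OF V(1)]])
  have self: "x \<in> per_loop x \<pi>" for \<pi>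
    unfolding per_loop_def by (auto intro: exI[of _ 0])
  have fixed: "?L \<pi> = 0" if "\<pi> x = x" for \<pi>
  proof -
    have "(\<pi> ^^ n) x = x" for n
      by (induction n) (use that in auto)
    then have "V \<inter> per_loop x \<pi> - {x} = {}"
      by (auto simp: per_loop_def)
    then show ?thesis by (simp only: sum.empty)
  qed
  have "(\<Sum>\<pi>\<in>?P. ?wt \<pi> * (\<Sum>y\<in>V \<inter> per_loop x \<pi>. \<psi> y)) = (\<Sum>\<pi>\<in>?P. ?wt \<pi> * \<psi> x + ?wt \<pi> * ?L \<pi>)"
  proof (rule sum.cong[OF refl])
    fix \<pi>
    have "(\<Sum>y\<in>V \<inter> per_loop x \<pi>. \<psi> y) = \<psi> x + ?L \<pi>"
      using V self by (intro sum.remove) auto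
    then show "?wt \<pi> * (\<Sum>y\<in>V \<inter> per_loop x \<pi>. \<psi> y) = ?wt \<pi> * \<psi> x + ?wt \<pi> * ?L \<pi>"
      by (simp add: distrib_left)
  qed
  also have "\<dots> = per_Z V w * \<psi> x + (\<Sum>\<pi>\<in>?P. ?wt \<pi> * ?L \<pi>)"
    by (simp add: sum.distrib per_Z_def sum_distrib_right)
  finally have split: "(\<Sum>\<pi>\<in>?P. ?wt \<pi> * (\<Sum>y\<in>V \<inter> per_loop x \<pi>. \<psi> y))
      = per_Z V w * \<psi> x + (\<Sum>\<pi>\<in>?P. ?wt \<pi> * ?L \<pi>)" .
  have "(\<Sum>\<pi>\<in>?P. ?wt \<pi> * ?L \<pi>) = (\<Sum>\<pi>\<in>?Q. ?wt \<pi> * ?L \<pi>)"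
    using fin fixed by (intro sum.mono_neutral_right) auto
  also have "\<dots> \<le> sum ?g ?S"
  proof (rule sum_le_sum_inj[where h = ?h])
    show "inj_on ?h ?Q"
    proof (rule inj_onI)
      fix \<pi> \<pi>' assume *: "\<pi> \<in> ?Q" "\<pi>' \<in> ?Q" "?h \<pi> = ?h \<pi>'"
      show "\<pi> = \<pi>'"
      proof
        fix v
        consider "v \<notin> V" | "v = inv \<pi> x" | "v \<in> V - {inv \<pi> x}" by blast
        then show "\<pi> v = \<pi>' v"
        proof cases
          case 1
          then show ?thesis using * by (metis (no_types, lifting) mem_Collect_eq permutes_not_in)
        next
          case 2
          then have "v = inv \<pi>' x" using * by simp
          then show ?thesis using 2 * by (metis (no_types, lifting) mem_Collect_eq permutes_inverses(1))
        next
          case 3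
          then have "\<pi> v = restrict \<pi> (V - {inv \<pi> x}) v" by simp
          also have "\<dots> = restrict \<pi>' (V - {inv \<pi>' x}) v"
            using *(3) by (metis prod.inject)
          also have "\<dots> = \<pi>' v" using 3 * by simp
          finally show ?thesis .
        qed
      qed
    qed
    show "?h ` ?Q \<subseteq> ?S"
    proof safe
      fix \<pi> assume \<pi>: "\<pi> permutes V" "\<pi> x \<noteq> x"
      show "inv \<pi> x \<in> V"
        using V \<pi> by (simp add: permutes_in_image permutes_inv)
      show False if "inv \<pi> x = x"
        using that \<pi> by (metis permutes_inverses(1))
      show "restrict \<pi> (V - {inv \<pi> x}) \<in> open_perms V x (inv \<pi> x)"
        using \<pi> V by (intro restrict_permutes_open_perms)
    qed
    show "finite ?S"
      using V by (auto intro: finite_open_perms)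
    show "0 \<le> ?g b" for b
      using w \<psi> by (auto simp: open_perm_weight_def split: prod.split
          intro!: mult_nonneg_nonneg prod_nonneg sum_nonneg)
  next
    fix \<pi> assume "\<pi> \<in> ?Q"
    then have \<pi>: "\<pi> permutes V" by simp
    let ?z = "inv \<pi> x"
    have z: "\<pi> ?z = x" "?z \<in> V"
      using \<pi> V by (auto simp: permutes_inverses permutes_in_image permutes_inv)
    have "?wt \<pi> = w ?z x * open_perm_weight w V x ?z (restrict \<pi> (V - {?z}))"
      using V z by (simp add: prod.remove[OF V(1) z(2)] open_perm_weight_def)
    moreover have "?L \<pi> \<le> (\<Sum>y\<in>V \<inter> open_perm_reach V x ?z (restrict \<pi> (V - {?z})). \<psi> y)"
      using V \<psi> per_loop_reach[OF \<pi> V(2)] by (intro sum_mono2) auto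
    moreover have "0 \<le> w ?z x * open_perm_weight w V x ?z (restrict \<pi> (V - {?z}))"
      using w unfolding open_perm_weight_def by (intro mult_nonneg_nonneg prod_nonneg)
    ultimately show "?wt \<pi> * ?L \<pi> \<le> ?g (?h \<pi>)"
      by (simp only: prod.case mult.assoc[symmetric] mult_left_mono)
  qed
  also have "sum ?g ?S = (\<Sum>z\<in>V - {x}. \<Sum>\<pi>\<in>open_perms V x z. ?g (z, \<pi>))"
    using V by (intro sum_Sigma_iterated) (auto intro: finite_open_perms)
  also have "\<dots> = (\<Sum>z\<in>V - {x}. w z x * (\<Sum>\<pi>\<in>open_perms V x z.
      open_perm_weight w V x z \<pi> * (\<Sum>y\<in>V \<inter> open_perm_reach V x z \<pi>. \<psi> y)))"
    by (simp only: prod.case sum_distrib_left)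
  finally show ?thesis
    unfolding split by (rule add_left_mono)
qed

section \<open>Double dimers\<close>

definition matching :: "'a set \<Rightarrow> ('a \<Rightarrow> 'a \<Rightarrow> real) \<Rightarrow> 'a set set \<Rightarrow> bool" where
  "matching V w M \<longleftrightarrow> M \<subseteq> edges V w \<and> (\<forall>e\<in>M. \<forall>f\<in>M. e \<inter> f \<noteq> {} \<longrightarrow> e = f)"

definition partner :: "'a \<Rightarrow> 'a set set \<Rightarrow> 'a" where
  "partner x M = (THE u. {x, u} \<in> M)"

definition closed_matchings ::
    "'a set \<Rightarrow> ('a \<Rightarrow> 'a \<Rightarrow> real) \<Rightarrow> ('a set set \<times> 'a set set) set" where
  "closed_matchings V w = {(M1, M2). matching V w M1 \<and> matching V w M2 \<and> \<Union>M1 = \<Union>M2}"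

text \<open>Alternating paths from \<open>x\<close> to \<open>z\<close> whose first edge lies in the second matching, together
  with closed loops. For \<open>x = z\<close> the path is trivial and \<open>x\<close> is covered by neither matching.\<close>

definition open_matchings ::
    "('a \<Rightarrow> 'a \<Rightarrow> real) \<Rightarrow> 'a set \<Rightarrow> 'a \<Rightarrow> 'a \<Rightarrow> ('a set set \<times> 'a set set) set" where
  "open_matchings w V x z = {(M1, M2). matching V w M1 \<and> matching V w M2 \<and> x \<notin> \<Union>M1 \<and>
     (\<forall>v. (v \<in> \<Union>M1 \<longleftrightarrow> v \<in> \<Union>M2) \<longleftrightarrow> (v = x \<longleftrightarrow> v = z))}"

text \<open>A doubled edge lies in both sets and so contributes its weight twice. Open
  configurations use \<open>U = V - {x, z}\<close>; for the trivial path this is what keeps the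
  uncovered vertex \<open>x\<close> from counting as a monomer.\<close>

definition matching_weight ::
    "('a \<Rightarrow> 'a \<Rightarrow> real) \<Rightarrow> 'a set \<Rightarrow> 'a set set \<times> 'a set set \<Rightarrow> real" where
  "matching_weight w U = (\<lambda>(M1, M2). (\<Prod>v\<in>U - \<Union>M1 - \<Union>M2. w v v) *
     (\<Prod>e\<in>M1. edge_weight w e) * (\<Prod>e\<in>M2. edge_weight w e))"

definition matching_reach :: "'a \<Rightarrow> 'a set set \<times> 'a set set \<Rightarrow> 'a set" where
  "matching_reach x = (\<lambda>(M1, M2). {y. (x, y) \<in> {(a, b). {a, b} \<in> M1 \<union> M2}\<^sup>*})"

definition cut :: "'a \<Rightarrow> 'a set set \<Rightarrow> 'a set set" where
  "cut x M = M - {{x, partner x M}}"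

lemma open_matchings_iff:
  "c \<in> open_matchings w V x z \<longleftrightarrow> matching V w (fst c) \<and> matching V w (snd c) \<and> x \<notin> \<Union>(fst c) \<and>
     (\<forall>v. (v \<in> \<Union>(fst c) \<longleftrightarrow> v \<in> \<Union>(snd c)) \<longleftrightarrow> (v = x \<longleftrightarrow> v = z))"
  unfolding open_matchings_def by (cases c) simp

lemma edgesE:
  assumes "e \<in> edges V w" "x \<in> e"
  obtains y where "e = {x, y}" "x \<noteq> y" "x \<in> V" "y \<in> V"
  using assms unfolding edges_def by (auto simp: insert_commute)

lemma finite_edges: "finite V \<Longrightarrow> finite (edges V w)"
  by (rule finite_subset[of _ "Pow V"]) (auto simp: edges_def)

lemma edges_mono: "U \<subseteq> V \<Longrightarrow> edges U w \<subseteq> edges V w"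
  unfolding edges_def by blast

lemma edges_remove: "e \<in> edges V w \<Longrightarrow> x \<notin> e \<Longrightarrow> e \<in> edges (V - {x}) w"
  unfolding edges_def by blast

lemma edge_weight_nonneg:
  assumes "e \<in> edges V w" "\<And>x y. w x y = w y x"
  shows "0 \<le> edge_weight w e"
  using assms edge_weight_doubleton[of w] unfolding edges_def by fastforce

lemma matching_Union_subset: "matching V w M \<Longrightarrow> \<Union>M \<subseteq> V"
  unfolding matching_def edges_def by blast

lemma finite_matching: "finite V \<Longrightarrow> matching V w M \<Longrightarrow> finite M"
  by (auto simp: matching_def intro: finite_subset finite_edges)

lemma matching_mono: "matching U w M \<Longrightarrow> U \<subseteq> V \<Longrightarrow> matching V w M"
  using edges_mono[of U V w] unfolding matching_def by blast

lemma matching_remove: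
  assumes "matching V w M" "x \<notin> \<Union>M"
  shows "matching (V - {x}) w M"
proof -
  have "e \<in> edges (V - {x}) w" if "e \<in> M" for e
    using assms that by (intro edges_remove) (auto simp: matching_def)
  then show ?thesis
    using assms(1) by (auto simp only: matching_def)
qed

lemma matching_disjoint:
  assumes "matching V w M" "e \<in> M" "f \<in> M" "v \<in> e" "v \<in> f"
  shows "e = f"
proof -
  have "e \<inter> f \<noteq> {}"
    using assms by blast
  then show ?thesis
    using assms(1-3) by (simp add: matching_def)
qed

lemma matching_unique:
  assumes "matching V w M" "{x, u} \<in> M" "{x, v} \<in> M"
  shows "u = v"
  using matching_disjoint[OF assms, of x] by (auto simp: doubleton_eq_iff)

lemma partner_eq: "matching V w M \<Longrightarrow> {x, u} \<in> M \<Longrightarrow> partner x M = u"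
  unfolding partner_def by (blast intro: matching_unique)

lemma partner:
  assumes "matching V w M" "x \<in> \<Union>M"
  shows "{x, partner x M} \<in> M" "partner x M \<noteq> x" "partner x M \<in> V"
proof -
  obtain e where e: "e \<in> M" "x \<in> e" using assms by blast
  then have "e \<in> edges V w" using assms by (auto simp: matching_def)
  from edgesE[OF this e(2)] obtain y where y: "e = {x, y}" "x \<noteq> y" "x \<in> V" "y \<in> V" .
  with partner_eq[OF assms(1)] e have "partner x M = y" by blast
  with y e show "{x, partner x M} \<in> M" "partner x M \<noteq> x" "partner x M \<in> V" by auto
qed

lemma matching_cut: "matching V w M \<Longrightarrow> matching V w (cut x M)"
  by (simp add: matching_def cut_def subset_iff)

lemma Union_cut:
  assumes "matching V w M" "x \<in> \<Union>M"
  shows "\<Union>(cut x M) = \<Union>M - {x, partner x M}"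
proof -
  have "e = {x, partner x M}" if "e \<in> M" "v \<in> e" "v = x \<or> v = partner x M" for e v
    using matching_disjoint[OF assms(1) that(1) partner(1)[OF assms] that(2)] that(3) by auto
  then show ?thesis
    unfolding cut_def by blast
qed

lemma prod_cut:
  assumes "finite V" "matching V w M" "x \<in> \<Union>M" "\<And>x y. w x y = w y x"
  shows "(\<Prod>e\<in>M. edge_weight w e) = w x (partner x M) * (\<Prod>e\<in>cut x M. edge_weight w e)"
  using prod.remove[OF finite_matching[OF assms(1,2)] partner(1)[OF assms(2,3)], of "edge_weight w"]
    edge_weight_doubleton[of w x "partner x M"] assms(4) by (simp add: cut_def)

lemma finite_matchings:
  assumes "finite V"
  shows "finite (closed_matchings V w)" "finite (open_matchings w V x z)"
proof -
  have "closed_matchings V w \<subseteq> Pow (edges V w) \<times> Pow (edges V w)"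
    "open_matchings w V x z \<subseteq> Pow (edges V w) \<times> Pow (edges V w)"
    by (auto simp: closed_matchings_def open_matchings_def matching_def)
  then show "finite (closed_matchings V w)" "finite (open_matchings w V x z)"
    using assms by (auto intro: finite_subset simp: finite_edges)
qed

lemma matching_weight_nonneg:
  assumes "\<And>x y. 0 \<le> w x y" "\<And>x y. w x y = w y x" "matching V w (fst c)" "matching V w (snd c)"
  shows "0 \<le> matching_weight w U c"
  using assms unfolding matching_weight_def matching_def
  by (cases c) (auto intro!: mult_nonneg_nonneg prod_nonneg edge_weight_nonneg)

lemma sum_closed_matchings_remove:
  assumes V: "finite V" "x \<in> V" and w: "\<And>x y. 0 \<le> w x y" "\<And>x y. w x y = w y x"
  shows "w x x * sum (matching_weight w (V - {x})) (closed_matchings (V - {x}) w)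
    \<le> sum (matching_weight w V) (closed_matchings V w)"
proof -
  have "w x x * matching_weight w (V - {x}) c = matching_weight w V c"
    if "c \<in> closed_matchings (V - {x}) w" for c
  proof -
    obtain M1 M2 where c: "c = (M1, M2)" by (cases c)
    have "x \<notin> \<Union>M1" "x \<notin> \<Union>M2"
      using that matching_Union_subset[of "V - {x}" w] by (fastforce simp: c closed_matchings_def)+
    then have "V - \<Union>M1 - \<Union>M2 = insert x (V - {x} - \<Union>M1 - \<Union>M2)"
      using V by blast
    then show ?thesis
      using V by (simp add: c matching_weight_def)
  qed
  then have "w x x * sum (matching_weight w (V - {x})) (closed_matchings (V - {x}) w)
      = sum (matching_weight w V) (closed_matchings (V - {x}) w)"
    by (simp add: sum_distrib_left)
  also have "\<dots> \<le> sum (matching_weight w V) (closed_matchings V w)"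
    using V w matching_mono[of "V - {x}" w _ V]
    by (intro sum_mono2 finite_matchings matching_weight_nonneg[where V = V])
       (auto simp: closed_matchings_def)
  finally show ?thesis .
qed

text \<open>Removing the edge from \<open>x\<close> to its partner \<open>u\<close> takes away the
  cover of \<open>u\<close> by the second matching. If \<open>u\<close> is not \<open>z\<close>, it
  was covered by both and is now covered by the first alone, so exchanging the matchings makes it a
  legitimate start. If \<open>u = z\<close>, it is left uncovered and the path is trivial.\<close>

lemma open_matchingsD:
  assumes "(M1, M2) \<in> open_matchings w V x z" "x \<noteq> z"
  shows "matching V w M1" "matching V w M2" "x \<in> \<Union>M2" "x \<notin> \<Union>M1"
    "partner x M2 \<in> V - {x}" "(cut x M2, M1) \<in> open_matchings w (V - {x}) (partner x M2) z"
proof -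
  let ?u = "partner x M2"
  show M: "matching V w M1" "matching V w M2" "x \<notin> \<Union>M1"
    using assms by (auto simp: open_matchings_def)
  have cov: "(v \<in> \<Union>M1 \<longleftrightarrow> v \<in> \<Union>M2) \<longleftrightarrow> (v = x \<longleftrightarrow> v = z)" for v
    using assms by (auto simp: open_matchings_def)
  show x: "x \<in> \<Union>M2"
    using cov[of x] M assms by blast
  note u = partner[OF M(2) x]
  show "?u \<in> V - {x}"
    using u by blast
  have cut: "\<Union>(cut x M2) = \<Union>M2 - {x, ?u}"
    by (rule Union_cut[OF M(2) x])
  have "?u \<in> \<Union>M2"
    using u by blast
  then have "(v \<in> \<Union>(cut x M2) \<longleftrightarrow> v \<in> \<Union>M1) \<longleftrightarrow> (v = ?u \<longleftrightarrow> v = z)" for v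
    using cov[of v] x M(3) assms(2) u(2) unfolding cut by blast
  moreover have "matching (V - {x}) w (cut x M2)"
    by (rule matching_remove[OF matching_cut[OF M(2)]]) (use cut in blast)
  moreover have "matching (V - {x}) w M1"
    by (rule matching_remove[OF M(1,3)])
  moreover have "?u \<notin> \<Union>(cut x M2)"
    using cut by blast
  ultimately show "(cut x M2, M1) \<in> open_matchings w (V - {x}) ?u z"
    unfolding open_matchings_iff fst_conv snd_conv by (intro conjI allI)
qed

lemma open_matchings_weight_step:
  assumes V: "finite V" "x \<noteq> z" and c: "(M1, M2) \<in> open_matchings w V x z"
    and w: "\<And>x y. w x y = w y x"
  shows "matching_weight w (V - {x, z}) (M1, M2)
    = w x (partner x M2) * matching_weight w (V - {x} - {partner x M2, z}) (cut x M2, M1)"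
proof -
  note D = open_matchingsD[OF c V(2)]
  have u: "partner x M2 \<in> \<Union>M2"
    using partner(1)[OF D(2,3)] by blast
  have "V - {x, z} - \<Union>M1 - \<Union>M2 = V - {x} - {partner x M2, z} - \<Union>(cut x M2) - \<Union>M1"
    unfolding Union_cut[OF D(2,3)] using u D(3) by blast
  then show ?thesis
    using prod_cut[OF V(1) D(2,3) w] by (simp add: matching_weight_def mult_ac)
qed

text \<open>As \<open>x\<close> is missed by the first matching, a walk that leaves \<open>x\<close>
  can only do so through its edge in the second one; the new start is thus forced.\<close>

lemma open_matchings_reach_step:
  assumes "x \<noteq> z" and c: "(M1, M2) \<in> open_matchings w V x z"
  shows "matching_reach x (M1, M2) \<subseteq> insert x (matching_reach (partner x M2) (cut x M2, M1))"
proof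
  note D = open_matchingsD[OF c assms(1)]
  let ?R = "{(a, b). {a, b} \<in> M1 \<union> M2}"
  fix y assume y: "y \<in> matching_reach x (M1, M2)"
  show "y \<in> insert x (matching_reach (partner x M2) (cut x M2, M1))"
  proof (cases "y = x")
    case False
    then obtain u where u: "(x, u) \<in> ?R" "(u, y) \<in> {(a, b) \<in> ?R. a \<noteq> x \<and> b \<noteq> x}\<^sup>*"
      using rtrancl_avoid_start[of x y ?R] y by (auto simp: matching_reach_def)
    have "{x, u} \<in> M2"
      using u(1) D(4) by auto
    then have "partner x M2 = u"
      by (rule partner_eq[OF D(2)])
    moreover have "{(a, b) \<in> ?R. a \<noteq> x \<and> b \<noteq> x} \<subseteq> {(a, b). {a, b} \<in> cut x M2 \<union> M1}"
      by (auto simp: cut_def doubleton_eq_iff)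
    from subsetD[OF rtrancl_mono[OF this] u(2)]
    have "(u, y) \<in> {(a, b). {a, b} \<in> cut x M2 \<union> M1}\<^sup>*" .
    ultimately show ?thesis
      by (simp add: matching_reach_def)
  qed simp
qed

lemma matching_reach_uncovered:
  assumes "x \<notin> \<Union>(fst c)" "x \<notin> \<Union>(snd c)"
  shows "matching_reach x c \<subseteq> {x}"
proof
  fix y assume "y \<in> matching_reach x c"
  then have "(x, y) \<in> {(a, b). {a, b} \<in> fst c \<union> snd c}\<^sup>*"
    by (simp add: matching_reach_def split_beta)
  then show "y \<in> {x}"
    by (cases rule: converse_rtranclE) (use assms in auto)
qed

lemma path_expansion_mdd:
  fixes w :: "'a \<Rightarrow> 'a \<Rightarrow> real"
  assumes w: "\<And>x y. 0 \<le> w x y" "\<And>x. 0 < w x x" "\<And>x y. w x y = w y x"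
  shows "path_expansion w (\<lambda>V. sum (matching_weight w V) (closed_matchings V w))
    (open_matchings w) (\<lambda>V x z. matching_weight w (V - {x, z})) (\<lambda>V x z. matching_reach x)
    (\<lambda>x c. partner x (snd c)) (\<lambda>V x z c. (cut x (snd c), fst c))"
proof
  fix V :: "'a set" and x z c
  show "0 \<le> matching_weight w (V - {x, z}) c" if "c \<in> open_matchings w V x z"
    using that w(1,3) by (intro matching_weight_nonneg[where V = V]) (simp_all only: open_matchings_iff)
  show "matching_reach x c \<subseteq> {x}" if "c \<in> open_matchings w V x x"
    using that unfolding open_matchings_iff by (intro matching_reach_uncovered) metis+
  show "0 < sum (matching_weight w {}) (closed_matchings {} w)"
  proof -
    have "closed_matchings {} w = {({}, {})}"
      by (auto simp: closed_matchings_def matching_def edges_def)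
    then show ?thesis by (simp add: matching_weight_def)
  qed
  assume V: "finite V"
  show "finite (open_matchings w V x z)"
    using V by (rule finite_matchings)
  assume x: "x \<in> V"
  show "w x x * sum (matching_weight w (V - {x})) (closed_matchings (V - {x}) w)
      \<le> sum (matching_weight w V) (closed_matchings V w)"
    by (rule sum_closed_matchings_remove[OF V x w(1,3)])
  \<comment> \<open>With equal end points the covering condition says that both matchings cover the
    same vertices, and \<open>x\<close> is not among them.\<close>
  have "open_matchings w V x x \<subseteq> closed_matchings (V - {x}) w"
    by (auto simp: open_matchings_def closed_matchings_def intro!: matching_remove)
  then show "(\<Sum>c\<in>open_matchings w V x x. matching_weight w (V - {x, x}) c)
      \<le> sum (matching_weight w (V - {x})) (closed_matchings (V - {x}) w)"
    using V w by (simp, intro sum_mono2 finite_matchings matching_weight_nonneg[where V = "V - {x}"])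
      (auto simp: closed_matchings_def)
  assume xz: "z \<in> V" "x \<noteq> z"
  show "inj_on (\<lambda>c. (partner x (snd c), (cut x (snd c), fst c))) (open_matchings w V x z)"
  proof (rule inj_onI, clarsimp)
    fix M1 M2 M2'
    assume *: "(M1, M2) \<in> open_matchings w V x z" "(M1, M2') \<in> open_matchings w V x z"
      "partner x M2 = partner x M2'" "cut x M2 = cut x M2'"
    have "{x, partner x M2} \<in> M2" "{x, partner x M2'} \<in> M2'"
      using open_matchingsD[OF *(1) xz(2)] open_matchingsD[OF *(2) xz(2)] partner(1) by metis+
    then show "M2 = M2'"
      using *(3,4) by (auto simp: cut_def)
  qed
  assume c: "c \<in> open_matchings w V x z"
  then have c': "(fst c, snd c) \<in> open_matchings w V x z" by simp
  show "partner x (snd c) \<in> V - {x}"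
    "(cut x (snd c), fst c) \<in> open_matchings w (V - {x}) (partner x (snd c)) z"
    using open_matchingsD[OF c' xz(2)] by blast+
  show "matching_weight w (V - {x, z}) c = w x (partner x (snd c)) *
      matching_weight w (V - {x} - {partner x (snd c), z}) (cut x (snd c), fst c)"
    using open_matchings_weight_step[OF V xz(2) c' w(3)] by simp
  show "matching_reach x c \<subseteq> insert x (matching_reach (partner x (snd c)) (cut x (snd c), fst c))"
    using open_matchings_reach_step[OF xz(2) c'] by simp
qed (rule w)+

section \<open>Opening a loop of a double-dimer configuration\<close>

lemma closed_matchings_cut:
  assumes c: "(M1, M2) \<in> closed_matchings V w" and x: "x \<in> \<Union>M1"
  shows "partner x M1 \<in> V - {x}" "(cut x M1, M2) \<in> open_matchings w V x (partner x M1)"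
proof -
  have M: "matching V w M1" "matching V w M2" "\<Union>M1 = \<Union>M2"
    using c by (auto simp: closed_matchings_def)
  note u = partner[OF M(1) x]
  show "partner x M1 \<in> V - {x}"
    using u by blast
  have cut: "\<Union>(cut x M1) = \<Union>M2 - {x, partner x M1}"
    by (simp only: Union_cut[OF M(1) x] M(3))
  have "x \<in> \<Union>M2" "partner x M1 \<in> \<Union>M2"
    using u x M(3)[symmetric] by auto
  \<comment> \<open>Cutting uncovers exactly \<open>x\<close> and its partner in the first matching
    while the second still covers both: they become the two ends of an open path. This includes the
    case of a doubled edge.\<close>
  then have "(v \<in> \<Union>(cut x M1) \<longleftrightarrow> v \<in> \<Union>M2) \<longleftrightarrow> (v = x \<longleftrightarrow> v = partner x M1)" for v
    using u(2) unfolding cut by (auto simp del: Union_iff)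
  moreover have "x \<notin> \<Union>(cut x M1)"
    using cut by blast
  ultimately show "(cut x M1, M2) \<in> open_matchings w V x (partner x M1)"
    unfolding open_matchings_iff fst_conv snd_conv
    by (intro conjI allI matching_cut M(1,2))
qed

lemma closed_matchings_weight_cut:
  assumes V: "finite V" and c: "(M1, M2) \<in> closed_matchings V w" and x: "x \<in> \<Union>M1"
    and w: "\<And>x y. w x y = w y x"
  shows "matching_weight w V (M1, M2)
    = w x (partner x M1) * matching_weight w (V - {x, partner x M1}) (cut x M1, M2)"
proof -
  have M: "matching V w M1" "matching V w M2" "\<Union>M1 = \<Union>M2"
    using c by (auto simp: closed_matchings_def)
  have "partner x M1 \<in> \<Union>M1"
    using partner[OF M(1) x] by blast
  then have "V - \<Union>M1 - \<Union>M2 = V - {x, partner x M1} - \<Union>(cut x M1) - \<Union>M2"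
    unfolding Union_cut[OF M(1) x] using x M(3) by blast
  then show ?thesis
    using prod_cut[OF V(1) M(1) x w] by (simp add: matching_weight_def mult_ac)
qed

text \<open>A simple path from \<open>x\<close> uses only one of the two edges at \<open>x\<close>, so the other one can be cut.\<close>

lemma matching_reach_closed:
  assumes c: "(M1, M2) \<in> closed_matchings V w"
    and y: "y \<in> matching_reach x (M1, M2)" "y \<noteq> x"
  shows "y \<in> matching_reach x (cut x M1, M2) \<union> matching_reach x (cut x M2, M1)"
proof -
  let ?R = "{(a, b). {a, b} \<in> M1 \<union> M2}"
  obtain u where u: "(x, u) \<in> ?R" "(u, y) \<in> {(a, b) \<in> ?R. a \<noteq> x \<and> b \<noteq> x}\<^sup>*"
    using rtrancl_avoid_start[of x y ?R] y by (auto simp: matching_reach_def)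
  have "y \<in> matching_reach x (cut x M, M')" if "{x, u} \<in> M'" "M \<union> M' = M1 \<union> M2" for M M'
  proof -
    let ?R' = "{(a, b). {a, b} \<in> cut x M \<union> M'}"
    \<comment> \<open>\<open>cut x M\<close> removes at most an edge containing \<open>x\<close>,
      whatever vertex \<open>partner\<close> returns, so no step avoiding \<open>x\<close> is
      lost.\<close>
    have "{(a, b) \<in> ?R. a \<noteq> x \<and> b \<noteq> x} \<subseteq> ?R'"
      using that(2) by (auto simp: cut_def doubleton_eq_iff)
    from subsetD[OF rtrancl_mono[OF this] u(2)] have "(u, y) \<in> ?R'\<^sup>*" .
    moreover have "(x, u) \<in> ?R'"
      using that(1) by simp
    ultimately have "(x, y) \<in> ?R'\<^sup>*"
      by (rule converse_rtrancl_into_rtrancl[rotated])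
    then show ?thesis by (simp add: matching_reach_def)
  qed
  from this[of M1 M2] this[of M2 M1] u(1) show ?thesis by auto
qed

text \<open>The factor 2 stands for the two directions in which the loop can be followed from \<open>x\<close>.\<close>

lemma sum_matching_loop_le:
  fixes w :: "'a \<Rightarrow> 'a \<Rightarrow> real"
  assumes V: "finite V" "x \<in> V" and w: "\<And>x y. 0 \<le> w x y" "\<And>x y. w x y = w y x"
    and \<psi>: "\<And>y. 0 \<le> \<psi> y"
  shows "(\<Sum>c\<in>closed_matchings V w. matching_weight w V c * (\<Sum>y\<in>V \<inter> matching_reach x c. \<psi> y))
    \<le> sum (matching_weight w V) (closed_matchings V w) * \<psi> x
      + 2 * (\<Sum>z\<in>V - {x}. w x z * (\<Sum>c\<in>open_matchings w V x z.
          matching_weight w (V - {x, z}) c * (\<Sum>y\<in>V \<inter> matching_reach x c. \<psi> y)))"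
proof -
  let ?P = "closed_matchings V w" and ?Q = "{c \<in> closed_matchings V w. x \<in> \<Union>(fst c)}"
  let ?wt = "matching_weight w V"
  let ?r = "\<lambda>c. \<Sum>y\<in>V \<inter> matching_reach x c. \<psi> y"
  let ?L = "\<lambda>c. \<Sum>y\<in>V \<inter> matching_reach x c - {x}. \<psi> y"
  let ?S = "Sigma (V - {x}) (open_matchings w V x)"
  define g where "g = (\<lambda>(z, c). w x z * (matching_weight w (V - {x, z}) c * ?r c))"
  define h where "h = (\<lambda>c :: 'a set set \<times> 'a set set. (partner x (fst c), (cut x (fst c), snd c)))"
  have r0: "0 \<le> ?r c" for c
    using \<psi> by (intro sum_nonneg) auto
  \<comment> \<open>Exchanging the matchings preserves closed configurations and their weight.
    Cutting the other edge at \<open>x\<close> therefore needs no second encoding: it is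
    \<open>h\<close> applied to the exchanged pair.\<close>
  have swap: "prod.swap c \<in> ?Q" if "c \<in> ?Q" for c
    using that by (cases c) (auto simp: closed_matchings_def)
  have h_in: "h ` ?Q \<subseteq> ?S"
  proof (rule image_subsetI)
    fix c assume "c \<in> ?Q"
    then have "(fst c, snd c) \<in> ?P" "x \<in> \<Union>(fst c)" by auto
    from closed_matchings_cut[OF this] show "h c \<in> ?S"
      by (simp add: h_def)
  qed
  have inj: "inj_on h ?Q"
  proof (rule inj_on_inverseI)
    fix c assume "c \<in> ?Q"
    then have "{x, partner x (fst c)} \<in> fst c"
      using partner(1)[of V w "fst c" x] by (auto simp: closed_matchings_def)
    then show "(\<lambda>(z, M1, M2). (insert {x, z} M1, M2)) (h c) = c"
      by (simp add: h_def cut_def insert_absorb)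
  qed
  have g0: "0 \<le> g b" if b: "b \<in> ?S" for b
  proof -
    have "matching V w (fst (snd b))" "matching V w (snd (snd b))"
      using b by (auto simp: open_matchings_iff)
    then show ?thesis
      using w r0 matching_weight_nonneg[of w V "snd b"]
      unfolding g_def by (simp add: split_beta)
  qed
  have finS: "finite ?S"
    using V by (auto intro: finite_matchings)
  have gh: "g (h c) = ?wt c * ?r (cut x (fst c), snd c)" if "c \<in> ?Q" for c
    using that closed_matchings_weight_cut[OF V(1), of "fst c" "snd c" w x] w(2)
    by (simp add: g_def h_def)
  have wt_swap: "?wt (prod.swap c) = ?wt c" if "c \<in> ?Q" for c
    using that by (cases c) (simp add: matching_weight_def closed_matchings_def mult_ac)
  have wt0: "0 \<le> ?wt c" if "c \<in> ?P" for c
    using that w by (intro matching_weight_nonneg[where V = V]) (auto simp: closed_matchings_def)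
  have self: "x \<in> matching_reach x c" for c
    by (cases c) (simp add: matching_reach_def)
  have "(\<Sum>c\<in>?P. ?wt c * ?r c) = (\<Sum>c\<in>?P. ?wt c * \<psi> x + ?wt c * ?L c)"
  proof (rule sum.cong[OF refl])
    fix c
    have "?r c = \<psi> x + ?L c"
      using V self by (intro sum.remove) auto
    then show "?wt c * ?r c = ?wt c * \<psi> x + ?wt c * ?L c"
      by (simp add: distrib_left)
  qed
  also have "\<dots> = sum ?wt ?P * \<psi> x + (\<Sum>c\<in>?P. ?wt c * ?L c)"
    by (simp add: sum.distrib sum_distrib_right)
  finally have split: "(\<Sum>c\<in>?P. ?wt c * ?r c) = sum ?wt ?P * \<psi> x + (\<Sum>c\<in>?P. ?wt c * ?L c)" .
  have "?L c = 0" if c: "c \<in> ?P - ?Q" for c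
  proof -
    have "x \<notin> \<Union>(fst c)" "x \<notin> \<Union>(snd c)"
      using c by (auto simp: closed_matchings_def simp del: Union_iff)
    then have "V \<inter> matching_reach x c - {x} = {}"
      using matching_reach_uncovered[of x c] by blast
    then show ?thesis by (simp only: sum.empty)
  qed
  then have "(\<Sum>c\<in>?P. ?wt c * ?L c) = (\<Sum>c\<in>?Q. ?wt c * ?L c)"
    using V by (intro sum.mono_neutral_right) (auto intro: finite_matchings)
  also have "\<dots> \<le> (\<Sum>c\<in>?Q. g (h c) + g (h (prod.swap c)))"
  proof (rule sum_mono)
    fix c assume c: "c \<in> ?Q"
    let ?c1 = "(cut x (fst c), snd c)" and ?c2 = "(cut x (snd c), fst c)"
    \<comment> \<open>The two openings together reach the whole loop. A vertex reached in both is
      counted twice, which only enlarges the bound as \<open>\<psi>\<close> is nonnegative.\<close>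
    have "V \<inter> matching_reach x c - {x}
        \<subseteq> (V \<inter> matching_reach x ?c1) \<union> (V \<inter> matching_reach x ?c2)"
      using c matching_reach_closed[of "fst c" "snd c" V w _ x] by auto
    then have "?L c \<le> sum \<psi> ((V \<inter> matching_reach x ?c1) \<union> (V \<inter> matching_reach x ?c2))"
      using V \<psi> by (intro sum_mono2) auto
    also have "\<dots> \<le> ?r ?c1 + ?r ?c2"
      using V \<psi> by (simp add: sum_Un sum_nonneg)
    finally have "?wt c * ?L c \<le> ?wt c * (?r ?c1 + ?r ?c2)"
      using wt0 c by (intro mult_left_mono) auto
    then show "?wt c * ?L c \<le> g (h c) + g (h (prod.swap c))"
      using gh[OF c] gh[OF swap[OF c]] wt_swap[OF c] by (simp add: distrib_left)
  qed
  also have "\<dots> = sum (g \<circ> h) ?Q + sum (g \<circ> (h \<circ> prod.swap)) ?Q"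
    by (simp add: sum.distrib)
  also have "\<dots> \<le> sum g ?S + sum g ?S"
  proof (rule add_mono)
    show "sum (g \<circ> h) ?Q \<le> sum g ?S"
      using g0 finS by (intro sum_le_sum_inj[OF inj h_in]) auto
    have "prod.swap ` ?Q \<subseteq> ?Q"
      using swap by (intro image_subsetI)
    then have "inj_on h (prod.swap ` ?Q)" "h ` prod.swap ` ?Q \<subseteq> ?S"
      by (rule inj_on_subset[OF inj], rule order.trans[OF image_mono h_in])
    then have "inj_on (h \<circ> prod.swap) ?Q" "(h \<circ> prod.swap) ` ?Q \<subseteq> ?S"
      unfolding image_comp[symmetric] by (intro comp_inj_on, auto simp only: inj_swap intro: inj_on_subset)
    then show "sum (g \<circ> (h \<circ> prod.swap)) ?Q \<le> sum g ?S"
      by (rule sum_le_sum_inj[OF _ _ finS _ g0]) (simp only: o_apply order_refl)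
  qed
  also have "\<dots> = 2 * (\<Sum>z\<in>V - {x}. \<Sum>c\<in>open_matchings w V x z. g (z, c))"
    using V sum_Sigma_iterated[of "V - {x}" "open_matchings w V x" g] by (simp add: finite_matchings)
  also have "\<dots> = 2 * (\<Sum>z\<in>V - {x}. w x z * (\<Sum>c\<in>open_matchings w V x z.
      matching_weight w (V - {x, z}) c * ?r c))"
    by (simp only: g_def prod.case sum_distrib_left)
  finally show ?thesis
    unfolding split by (rule add_left_mono)
qed

section \<open>Correspondence between 0/1 edge configurations and sets of edges\<close>

definition indicator_config :: "'a set \<Rightarrow> ('a \<Rightarrow> 'a \<Rightarrow> real) \<Rightarrow> 'a set set \<Rightarrow> 'a set \<Rightarrow> nat" where
  "indicator_config V w M = (\<lambda>e\<in>edges V w. if e \<in> M then 1 else 0)"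

definition support :: "'a set \<Rightarrow> ('a \<Rightarrow> 'a \<Rightarrow> real) \<Rightarrow> ('a set \<Rightarrow> nat) \<Rightarrow> 'a set set" where
  "support V w m = {e \<in> edges V w. m e = 1}"

lemma indicator_config_in: "indicator_config V w M \<in> dimer_configs V w"
  by (auto simp: dimer_configs_def indicator_config_def)

lemma support_indicator_config: "M \<subseteq> edges V w \<Longrightarrow> support V w (indicator_config V w M) = M"
  by (auto simp: support_def indicator_config_def)

lemma indicator_config_support:
  assumes "m \<in> dimer_configs V w"
  shows "indicator_config V w (support V w m) = m"
proof
  fix e
  show "indicator_config V w (support V w m) e = m e"
    using PiE_mem[of m "edges V w" "\<lambda>_. {0, 1}" e] PiE_arb[of m "edges V w" "\<lambda>_. {0, 1}" e] assms
    by (auto simp: dimer_configs_def indicator_config_def support_def)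
qed

lemma dimer_degree_indicator_config:
  assumes "finite V" "matching V w M"
  shows "dimer_degree V w (indicator_config V w M) x = (if x \<in> \<Union>M then 1 else 0)"
proof -
  have M: "M \<subseteq> edges V w" using assms by (simp add: matching_def)
  have "dimer_degree V w (indicator_config V w M) x
      = (\<Sum>y | y \<in> V \<and> {x, y} \<in> edges V w. if {x, y} \<in> M then 1 else 0)"
    unfolding dimer_degree_def by (intro sum.cong) (auto simp: indicator_config_def)
  also have "\<dots> = card {y. (y \<in> V \<and> {x, y} \<in> edges V w) \<and> {x, y} \<in> M}"
    using assms by (simp add: sum.If_cases Int_def)
  also have "{y. (y \<in> V \<and> {x, y} \<in> edges V w) \<and> {x, y} \<in> M}
      = (if x \<in> \<Union>M then {partner x M} else {})"
  proof (cases "x \<in> \<Union>M")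
    case True
    note p = partner[OF assms(2) this]
    have "{y. (y \<in> V \<and> {x, y} \<in> edges V w) \<and> {x, y} \<in> M} = {partner x M}"
      using M p partner_eq[OF assms(2)] by blast
    then show ?thesis
      by (simp only: True if_True)
  qed auto
  finally show ?thesis by simp
qed

text \<open>Two different selected edges meeting in a vertex would give it degree at least
  2.\<close>

lemma matching_support:
  assumes V: "finite V" and m: "m \<in> dimer_configs V w"
    and deg: "\<And>x. x \<in> V \<Longrightarrow> dimer_degree V w m x \<le> 1"
  shows "matching V w (support V w m)"
  unfolding matching_def
proof (intro conjI ballI impI)
  show "support V w m \<subseteq> edges V w" by (auto simp: support_def)
  fix e f assume e: "e \<in> support V w m" and f: "f \<in> support V w m" and "e \<inter> f \<noteq> {}"
  then obtain v where v: "v \<in> e" "v \<in> f" by blast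
  from e f have ef: "e \<in> edges V w" "f \<in> edges V w" "m e = 1" "m f = 1"
    by (auto simp: support_def)
  obtain a where a: "e = {v, a}" "v \<in> V" "a \<in> V"
    using edgesE[OF ef(1) v(1)] by blast
  obtain b where b: "f = {v, b}" "b \<in> V"
    using edgesE[OF ef(2) v(2)] by blast
  show "e = f"
  proof (rule ccontr)
    assume "e \<noteq> f"
    then have "a \<noteq> b" using a b by auto
    then have "2 = (\<Sum>y\<in>{a, b}. m {v, y})"
      using a b ef by simp
    also have "\<dots> \<le> dimer_degree V w m v"
      unfolding dimer_degree_def using V a b ef by (intro sum_mono2) auto
    also have "\<dots> \<le> 1" using a by (intro deg)
    finally show False by simp
  qed
qed

lemma Union_support_iff:
  assumes "finite V" "matching V w (support V w m)" "m \<in> dimer_configs V w"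
  shows "z \<in> \<Union>(support V w m) \<longleftrightarrow> dimer_degree V w m z = 1"
proof -
  have "dimer_degree V w m z = (if z \<in> \<Union>(support V w m) then 1 else 0)"
    using dimer_degree_indicator_config[OF assms(1,2), of z]
    by (simp only: indicator_config_support[OF assms(3)])
  then show ?thesis
    by (cases "z \<in> \<Union>(support V w m)") (simp_all del: Union_iff)
qed

lemma mdd_weight_indicator_config:
  assumes V: "finite V" "U \<subseteq> V" and M: "matching V w M1" "matching V w M2"
  shows "mdd_weight V w U (indicator_config V w M1, indicator_config V w M2)
    = (\<Prod>v\<in>U - \<Union>M1. w v v) * (\<Prod>e\<in>M1. edge_weight w e) * (\<Prod>e\<in>M2. edge_weight w e)"
proof -
  have fin: "finite U" "finite (edges V w)"
    using V by (auto intro: finite_subset finite_edges)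
  have "(\<Prod>e\<in>edges V w. edge_weight w e ^ indicator_config V w M e) = (\<Prod>e\<in>M. edge_weight w e)"
    if "matching V w M" for M
  proof -
    have "(\<Prod>e\<in>edges V w. edge_weight w e ^ indicator_config V w M e)
        = (\<Prod>e\<in>edges V w. if e \<in> M then edge_weight w e else 1)"
      by (intro prod.cong) (auto simp: indicator_config_def)
    also have "\<dots> = (\<Prod>e\<in>edges V w \<inter> M. edge_weight w e)"
      using fin by (simp add: prod.inter_restrict)
    also have "edges V w \<inter> M = M"
      using that by (auto simp: matching_def)
    finally show ?thesis .
  qed
  moreover have "(\<Prod>z\<in>U. w z z ^ (1 - dimer_degree V w (indicator_config V w M1) z))
      = (\<Prod>z\<in>U - \<Union>M1. w z z)"
  proof -
    have "(\<Prod>z\<in>U. w z z ^ (1 - dimer_degree V w (indicator_config V w M1) z))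
        = (\<Prod>z\<in>U. if z \<in> - \<Union>M1 then w z z else 1)"
      using dimer_degree_indicator_config[OF V(1) M(1)] by (intro prod.cong) auto
    also have "\<dots> = (\<Prod>z\<in>U \<inter> - \<Union>M1. w z z)"
      using fin by (simp add: prod.inter_restrict)
    finally show ?thesis by (simp add: Diff_eq)
  qed
  ultimately show ?thesis
    using M by (simp add: mdd_weight_def power_add prod.distrib)
qed

lemma mdd_loop_indicator_config:
  assumes "matching V w M1" "matching V w M2"
  shows "mdd_loop V w x (indicator_config V w M1, indicator_config V w M2)
    = matching_reach x (M1, M2)"
proof -
  have "M1 \<subseteq> edges V w" "M2 \<subseteq> edges V w"
    using assms by (simp_all add: matching_def)
  then have "e \<in> edges V w \<and> indicator_config V w M1 e + indicator_config V w M2 e > 0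
      \<longleftrightarrow> e \<in> M1 \<union> M2" for e
    using subsetD[of M1 "edges V w" e] subsetD[of M2 "edges V w" e]
    by (cases "e \<in> edges V w") (auto simp: indicator_config_def)
  then show ?thesis by (simp only: mdd_loop_def matching_reach_def prod.case)
qed

abbreviation indicator_configs ::
    "'a set \<Rightarrow> ('a \<Rightarrow> 'a \<Rightarrow> real) \<Rightarrow> 'a set set \<times> 'a set set \<Rightarrow> ('a set \<Rightarrow> nat) \<times> ('a set \<Rightarrow> nat)"
  where "indicator_configs V w \<equiv> map_prod (indicator_config V w) (indicator_config V w)"

lemma inj_on_indicator_configs:
  assumes "\<And>c. c \<in> S \<Longrightarrow> matching V w (fst c) \<and> matching V w (snd c)"
  shows "inj_on (indicator_configs V w) S"
  by (rule inj_on_inverseI[where g = "map_prod (support V w) (support V w)"])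
     (use assms in \<open>auto simp: support_indicator_config matching_def\<close>)

lemma mdd_configs_eq:
  assumes V: "finite V"
  shows "mdd_configs V w = indicator_configs V w ` closed_matchings V w"
proof (intro equalityI subsetI)
  fix m assume m: "m \<in> mdd_configs V w"
  obtain m1 m2 where m12: "m = (m1, m2)" by (cases m)
  have d: "m1 \<in> dimer_configs V w" "m2 \<in> dimer_configs V w"
    and deg: "\<And>x. x \<in> V \<Longrightarrow> dimer_degree V w m1 x = dimer_degree V w m2 x"
      "\<And>x. x \<in> V \<Longrightarrow> dimer_degree V w m1 x \<in> {0, 1}"
    using m by (auto simp: mdd_configs_def m12)
  let ?M1 = "support V w m1" and ?M2 = "support V w m2"
  have "dimer_degree V w m1 z \<le> 1 \<and> dimer_degree V w m2 z \<le> 1" if "z \<in> V" for z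
    using deg[OF that] by auto
  then have M: "matching V w ?M1" "matching V w ?M2"
    by (simp_all add: matching_support V d)
  have cov: "z \<in> \<Union>?M1 \<longleftrightarrow> dimer_degree V w m1 z = 1" "z \<in> \<Union>?M2 \<longleftrightarrow> dimer_degree V w m2 z = 1" for z
    by (rule Union_support_iff[OF V] M d)+
  have "z \<in> \<Union>?M1 \<longleftrightarrow> z \<in> \<Union>?M2" for z
  proof (cases "z \<in> V")
    case True
    then show ?thesis
      by (simp only: cov deg(1))
  next
    case False
    then show ?thesis
      using matching_Union_subset[OF M(1)] matching_Union_subset[OF M(2)] by blast
  qed
  then have "\<Union>?M1 = \<Union>?M2" by (rule set_eqI)
  then have "(?M1, ?M2) \<in> closed_matchings V w"
    using M by (simp add: closed_matchings_def)
  then show "m \<in> indicator_configs V w ` closed_matchings V w"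
    by (rule rev_image_eqI) (simp add: m12 indicator_config_support d)
next
  fix m assume "m \<in> indicator_configs V w ` closed_matchings V w"
  then obtain M1 M2 where m: "m = (indicator_config V w M1, indicator_config V w M2)"
    and M: "matching V w M1" "matching V w M2" "\<Union>M1 = \<Union>M2"
    by (auto simp: closed_matchings_def)
  show "m \<in> mdd_configs V w"
    unfolding mdd_configs_def m
    by (simp add: indicator_config_in dimer_degree_indicator_config[OF V] M)
qed

text \<open>Only an inclusion, since \<open>open_matchings\<close> also contains paths whose last
  edge lies in the first matching, while here both ends are covered by the second. The extra terms
  are nonnegative, which suffices for upper bounds.\<close>

lemma mdd_open_configs_subset:
  assumes V: "finite V" "x \<in> V" "y \<in> V" "x \<noteq> y"
  shows "mdd_open_configs V w x y \<subseteq> indicator_configs V w ` open_matchings w V x y"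
proof
  fix m assume m: "m \<in> mdd_open_configs V w x y"
  obtain m1 m2 where m12: "m = (m1, m2)" by (cases m)
  have d: "m1 \<in> dimer_configs V w" "m2 \<in> dimer_configs V w"
    and deg: "\<And>z. z \<in> V - {x, y} \<Longrightarrow> dimer_degree V w m1 z = dimer_degree V w m2 z"
      "\<And>z. z \<in> V - {x, y} \<Longrightarrow> dimer_degree V w m1 z \<in> {0, 1}"
      "dimer_degree V w m1 x = 0" "dimer_degree V w m1 y = 0"
      "dimer_degree V w m2 x = 1" "dimer_degree V w m2 y = 1"
    using m unfolding mdd_open_configs_def m12 mem_Collect_eq prod.case by blast+
  let ?M1 = "support V w m1" and ?M2 = "support V w m2"
  have le: "dimer_degree V w m1 z \<le> 1 \<and> dimer_degree V w m2 z \<le> 1" if "z \<in> V" for z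
    using deg(1,2)[of z] deg(3-6) that by (cases "z = x \<or> z = y") auto
  then have M: "matching V w ?M1" "matching V w ?M2"
    by (simp_all add: matching_support V d)
  have cov: "z \<in> \<Union>?M1 \<longleftrightarrow> dimer_degree V w m1 z = 1" "z \<in> \<Union>?M2 \<longleftrightarrow> dimer_degree V w m2 z = 1" for z
    by (rule Union_support_iff[OF V(1)] M d)+
  have "(z \<in> \<Union>?M1 \<longleftrightarrow> z \<in> \<Union>?M2) \<longleftrightarrow> (z = x \<longleftrightarrow> z = y)" for z
  proof (cases "z \<in> V - {x, y}")
    case True
    then show ?thesis using deg(1)[of z] unfolding cov by auto
  next
    case False
    then consider "z \<notin> V" | "z = x" | "z = y" by blast
    then show ?thesis
    proof cases
      case 1
      then show ?thesis
        using matching_Union_subset[OF M(1)] matching_Union_subset[OF M(2)] V by blast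
    qed (use deg(3-6) V(4) in \<open>simp_all only: cov, simp_all\<close>)
  qed
  moreover have "x \<notin> \<Union>?M1"
    unfolding cov using deg(3) by simp
  ultimately have "(?M1, ?M2) \<in> open_matchings w V x y"
    unfolding open_matchings_iff fst_conv snd_conv by (intro conjI allI M)
  then show "m \<in> indicator_configs V w ` open_matchings w V x y"
    by (rule rev_image_eqI) (simp add: m12 indicator_config_support d)
qed

lemma sum_mdd_configs:
  assumes "finite V"
  shows "sum f (mdd_configs V w) = (\<Sum>c\<in>closed_matchings V w. f (indicator_configs V w c))"
  unfolding mdd_configs_eq[OF assms]
  by (subst sum.reindex) (auto simp: closed_matchings_def intro!: inj_on_indicator_configs)

lemma mdd_weight_closed:
  assumes V: "finite V" and c: "c \<in> closed_matchings V w"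
  shows "mdd_weight V w V (indicator_configs V w c) = matching_weight w V c"
proof -
  obtain M1 M2 where c': "c = (M1, M2)" and M: "matching V w M1" "matching V w M2" "\<Union>M1 = \<Union>M2"
    using c by (auto simp: closed_matchings_def)
  have "V - \<Union>M1 = V - \<Union>M1 - \<Union>M2"
    unfolding M(3) by blast
  then show ?thesis
    using mdd_weight_indicator_config[OF V subset_refl M(1,2)] by (simp add: c' matching_weight_def)
qed

lemma mdd_Z_eq:
  assumes "finite V"
  shows "mdd_Z V w = sum (matching_weight w V) (closed_matchings V w)"
  unfolding mdd_Z_def sum_mdd_configs[OF assms]
  by (intro sum.cong) (simp_all add: mdd_weight_closed[OF assms])

section \<open>Tilted sums\<close>

lemma mdd_weight_nonneg:
  assumes "\<And>x y. 0 \<le> w x y" "\<And>x y. w x y = w y x"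
  shows "0 \<le> mdd_weight V w U m"
  using assms unfolding mdd_weight_def
  by (cases m) (auto intro!: mult_nonneg_nonneg prod_nonneg zero_le_power edge_weight_nonneg)

text \<open>One constant for all four functions: \<open>1 / (a - s)\<close> comes from the path sums
  behind the two-point functions, 1 from the vertex \<open>x\<close> in its own loop, and the last
  term from the rest of the loop, with 2 for the directions of a double-dimer loop.\<close>

definition tilt_const :: "real \<Rightarrow> real \<Rightarrow> real" where
  "tilt_const a s = 1 / (a - s) + 1 + 2 * s * (a / (a - s)\<^sup>2)"

lemma tilt_const_ge:
  assumes "0 \<le> s" "s < a"
  shows "1 / (a - s) \<le> tilt_const a s" "1 + s * (a / (a - s)\<^sup>2) \<le> tilt_const a s"
    "1 + 2 * s * (a / (a - s)\<^sup>2) \<le> tilt_const a s" "1 \<le> tilt_const a s"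
proof -
  define t where "t = s * (a / (a - s)\<^sup>2)"
  have "0 \<le> 1 / (a - s)" "0 \<le> t" "tilt_const a s = 1 / (a - s) + 1 + 2 * t"
    using assms by (simp_all add: tilt_const_def t_def)
  then show "1 / (a - s) \<le> tilt_const a s" "1 + s * (a / (a - s)\<^sup>2) \<le> tilt_const a s"
    "1 + 2 * s * (a / (a - s)\<^sup>2) \<le> tilt_const a s" "1 \<le> tilt_const a s"
    unfolding mult.assoc t_def[symmetric] by linarith+
qed

text \<open>\<open>a\<close> is the least gain from deleting a vertex and \<open>s\<close> the
  largest mass of one step, so \<open>s < a\<close> is the killing. Both the constant 1 and
  \<open>\<psi>\<close> must be supersolutions with the same \<open>s\<close>, because reach sums
  use the untilted bound too.\<close>

locale tilted_weights =
  fixes V :: "'a set" and w :: "'a \<Rightarrow> 'a \<Rightarrow> real" and \<psi> :: "'a \<Rightarrow> real" and a s :: real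
  assumes finite_V: "finite V"
    and w_nonneg: "0 \<le> w x y"
    and w_sym: "w x y = w y x"
    and w_diag: "a \<le> w x x"
    and w_off: "x \<in> V \<Longrightarrow> (\<Sum>u\<in>V - {x}. w x u) \<le> s"
    and w_off_tilted: "x \<in> V \<Longrightarrow> (\<Sum>u\<in>V - {x}. w x u * \<psi> u) \<le> s * \<psi> x"
    and \<psi>_nonneg: "0 \<le> \<psi> x"
    and s_nonneg: "0 \<le> s" and s_less: "s < a"
begin

lemma w_diag_pos: "0 < w x x"
  using w_diag[of x] s_nonneg s_less by linarith

text \<open>Bounds the weight of the edge that was cut to open a loop, so that the sum over the far
  end becomes a plain reach sum.\<close>

lemma w_off_le: "x \<in> V \<Longrightarrow> z \<in> V - {x} \<Longrightarrow> w x z \<le> s"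
  using member_le_sum[of z "V - {x}" "w x"] w_off[of x] finite_V w_nonneg by force

lemma sum_per_G_le:
  assumes x: "x \<in> V"
  shows "(\<Sum>y\<in>V. \<psi> y * per_G V w x y) \<le> tilt_const a s * \<psi> x"
proof -
  interpret per: path_expansion w "\<lambda>V. per_Z V w" open_perms "open_perm_weight w" open_perm_reach
    "\<lambda>x \<pi>. \<pi> x" "\<lambda>V x z \<pi>. restrict \<pi> (V - {x} - {z})"
    using w_nonneg w_diag_pos by (rule path_expansion_per)
  have "per_G V w x y = per.path_sum V x y / per_Z V w" for y
    by (simp add: per_G_def per.path_sum_def open_perms_def open_perm_weight_def)
  then have "(\<Sum>y\<in>V. \<psi> y * per_G V w x y) = (\<Sum>y\<in>V. \<psi> y * per.path_sum V x y) / per_Z V w"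
    by (simp add: sum_divide_distrib)
  also have "\<dots> \<le> (per_Z V w * \<psi> x / (a - s)) / per_Z V w"
    using per.sum_path_sum_le[OF finite_V subset_refl x w_diag w_off_tilted \<psi>_nonneg s_nonneg s_less]
      per.Z_pos[OF finite_V] by (intro divide_right_mono) auto
  also have "\<dots> = 1 / (a - s) * \<psi> x"
    using per.Z_pos[OF finite_V] by simp
  also have "\<dots> \<le> tilt_const a s * \<psi> x"
    by (intro mult_right_mono tilt_const_ge[OF s_nonneg s_less] \<psi>_nonneg)
  finally show ?thesis .
qed

lemma sum_mdd_G_le:
  assumes x: "x \<in> V"
  shows "(\<Sum>y\<in>V. \<psi> y * mdd_G V w x y) \<le> tilt_const a s * \<psi> x"
proof -
  let ?Z = "\<lambda>V. sum (matching_weight w V) (closed_matchings V w)"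
  interpret mdd: path_expansion w ?Z "open_matchings w" "\<lambda>V x z. matching_weight w (V - {x, z})"
    "\<lambda>V x z. matching_reach x" "\<lambda>x c. partner x (snd c)" "\<lambda>V x z c. (cut x (snd c), fst c)"
    using w_nonneg w_diag_pos w_sym by (rule path_expansion_mdd)
  have Z: "0 < ?Z V" by (rule mdd.Z_pos[OF finite_V])
  have "mdd_G V w x y \<le> mdd.path_sum V x y / ?Z V" if y: "y \<in> V" for y
  proof (cases "x = y")
    case True
    then show ?thesis
      using mdd.path_sum_nonneg[of V x y] Z by (simp add: mdd_G_def)
  next
    case False
    have "(\<Sum>m\<in>mdd_open_configs V w x y. mdd_weight V w (V - {x, y}) m)
        \<le> (\<Sum>m\<in>indicator_configs V w ` open_matchings w V x y. mdd_weight V w (V - {x, y}) m)"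
      by (intro sum_mono2 finite_imageI finite_matchings finite_V
          mdd_open_configs_subset[OF finite_V x y False] mdd_weight_nonneg[OF w_nonneg w_sym])
    also have "\<dots> = (\<Sum>c\<in>open_matchings w V x y. mdd_weight V w (V - {x, y}) (indicator_configs V w c))"
      by (subst sum.reindex) (auto simp: open_matchings_def intro!: inj_on_indicator_configs)
    also have "\<dots> = mdd.path_sum V x y"
      unfolding mdd.path_sum_def
    proof (rule sum.cong[OF refl])
      fix c assume "c \<in> open_matchings w V x y"
      then obtain M1 M2 where c: "c = (M1, M2)" and M: "matching V w M1" "matching V w M2"
        and cov: "\<And>v. (v \<in> \<Union>M1 \<longleftrightarrow> v \<in> \<Union>M2) \<longleftrightarrow> (v = x \<longleftrightarrow> v = y)"
        by (auto simp only: open_matchings_def)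
      have "V - {x, y} - \<Union>M1 = V - {x, y} - \<Union>M1 - \<Union>M2"
        using cov by blast
      then show "mdd_weight V w (V - {x, y}) (indicator_configs V w c)
          = matching_weight w (V - {x, y}) c"
        using mdd_weight_indicator_config[OF finite_V _ M, of "V - {x, y}"]
        by (simp add: c matching_weight_def)
    qed
    finally show ?thesis
      using False Z by (simp add: mdd_G_def mdd_Z_eq[OF finite_V] divide_right_mono)
  qed
  then have "(\<Sum>y\<in>V. \<psi> y * mdd_G V w x y) \<le> (\<Sum>y\<in>V. \<psi> y * (mdd.path_sum V x y / ?Z V))"
    by (intro sum_mono mult_left_mono \<psi>_nonneg)
  also have "\<dots> = (\<Sum>y\<in>V. \<psi> y * mdd.path_sum V x y) / ?Z V"
    by (simp add: sum_divide_distrib)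
  also have "\<dots> \<le> (?Z V * \<psi> x / (a - s)) / ?Z V"
    using mdd.sum_path_sum_le[OF finite_V subset_refl x w_diag w_off_tilted \<psi>_nonneg s_nonneg s_less] Z
    by (intro divide_right_mono) auto
  also have "\<dots> = 1 / (a - s) * \<psi> x"
    using Z by simp
  also have "\<dots> \<le> tilt_const a s * \<psi> x"
    by (intro mult_right_mono tilt_const_ge[OF s_nonneg s_less] \<psi>_nonneg)
  finally show ?thesis .
qed

lemma sum_per_loop_prob_le:
  assumes x: "x \<in> V"
  shows "(\<Sum>y\<in>V. \<psi> y * measure (per_measure V w) {\<pi>. \<pi> permutes V \<and> y \<in> per_loop x \<pi>}) \<le> tilt_const a s * \<psi> x"
proof -
  interpret per: path_expansion w "\<lambda>V. per_Z V w" open_perms "open_perm_weight w" open_perm_reach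
    "\<lambda>x \<pi>. \<pi> x" "\<lambda>V x z \<pi>. restrict \<pi> (V - {x} - {z})"
    using w_nonneg w_diag_pos by (rule path_expansion_per)
  have Z: "0 < per_Z V w" by (rule per.Z_pos[OF finite_V])
  \<comment> \<open>The cut step runs from \<open>z\<close> to \<open>x\<close>, against the
    direction of the row-sum bound; symmetry of \<open>w\<close> gives the bound \<open>s\<close>
    for it.\<close>
  have "(\<Sum>z\<in>V - {x}. w z x * per.reach_sum \<psi> V x z) \<le> (\<Sum>z\<in>V - {x}. s * per.reach_sum \<psi> V x z)"
    using w_off_le[OF x] by (intro sum_mono mult_right_mono per.reach_sum_nonneg \<psi>_nonneg) (simp add: w_sym)
  also have "\<dots> \<le> s * (\<Sum>z\<in>V. per.reach_sum \<psi> V x z)"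
    unfolding sum_distrib_left[symmetric] using finite_V s_nonneg
    by (intro mult_left_mono sum_mono2 per.reach_sum_nonneg \<psi>_nonneg) auto
  also have "\<dots> \<le> s * (per_Z V w * \<psi> x * (a / (a - s)\<^sup>2))"
    by (intro mult_left_mono s_nonneg s_less per.sum_reach_sum_le[OF finite_V subset_refl x] w_diag
        w_off w_off_tilted \<psi>_nonneg)
  finally have "per_Z V w * \<psi> x + (\<Sum>z\<in>V - {x}. w z x * per.reach_sum \<psi> V x z)
      \<le> per_Z V w * ((1 + s * (a / (a - s)\<^sup>2)) * \<psi> x)"
    by (simp add: algebra_simps)
  also have "\<dots> \<le> per_Z V w * (tilt_const a s * \<psi> x)"
    using Z by (intro mult_left_mono mult_right_mono tilt_const_ge[OF s_nonneg s_less] \<psi>_nonneg) simp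
  finally have bound: "(\<Sum>\<pi> | \<pi> permutes V. (\<Prod>v\<in>V. w v (\<pi> v)) * (\<Sum>y\<in>V \<inter> per_loop x \<pi>. \<psi> y))
      \<le> per_Z V w * (tilt_const a s * \<psi> x)"
    using sum_per_loop_le[of V x w \<psi>, OF finite_V x w_nonneg \<psi>_nonneg] unfolding per.reach_sum_def by linarith
  have "(\<Sum>y\<in>V. \<psi> y * measure (per_measure V w) {\<pi>. \<pi> permutes V \<and> y \<in> per_loop x \<pi>})
      = (\<Sum>\<pi> | \<pi> permutes V. (\<Prod>v\<in>V. w v (\<pi> v)) / per_Z V w * (\<Sum>y\<in>V \<inter> per_loop x \<pi>. \<psi> y))"
    unfolding per_measure_def
    using sum_measure_point_measure[of "{\<pi>. \<pi> permutes V}" "\<lambda>\<pi>. (\<Prod>v\<in>V. w v (\<pi> v)) / per_Z V w"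
        V \<psi> "per_loop x"] finite_V Z w_nonneg
    by (simp add: finite_permutations prod_nonneg)
  also have "\<dots> = (\<Sum>\<pi> | \<pi> permutes V. (\<Prod>v\<in>V. w v (\<pi> v)) * (\<Sum>y\<in>V \<inter> per_loop x \<pi>. \<psi> y)) / per_Z V w"
    by (simp add: sum_divide_distrib)
  also have "\<dots> \<le> tilt_const a s * \<psi> x"
    using bound Z by (simp add: divide_le_eq mult.commute)
  finally show ?thesis .
qed

lemma sum_mdd_loop_prob_le:
  assumes x: "x \<in> V"
  shows "(\<Sum>y\<in>V. \<psi> y * measure (mdd_measure V w) {m \<in> mdd_configs V w. y \<in> mdd_loop V w x m}) \<le> tilt_const a s * \<psi> x"
proof -
  let ?Z = "\<lambda>V. sum (matching_weight w V) (closed_matchings V w)"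
  interpret mdd: path_expansion w ?Z "open_matchings w" "\<lambda>V x z. matching_weight w (V - {x, z})"
    "\<lambda>V x z. matching_reach x" "\<lambda>x c. partner x (snd c)" "\<lambda>V x z c. (cut x (snd c), fst c)"
    using w_nonneg w_diag_pos w_sym by (rule path_expansion_mdd)
  have Z: "0 < ?Z V" by (rule mdd.Z_pos[OF finite_V])
  have "(\<Sum>z\<in>V - {x}. w x z * mdd.reach_sum \<psi> V x z) \<le> (\<Sum>z\<in>V - {x}. s * mdd.reach_sum \<psi> V x z)"
    using w_off_le[OF x] by (intro sum_mono mult_right_mono mdd.reach_sum_nonneg \<psi>_nonneg)
  also have "\<dots> \<le> s * (\<Sum>z\<in>V. mdd.reach_sum \<psi> V x z)"
    unfolding sum_distrib_left[symmetric] using finite_V s_nonneg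
    by (intro mult_left_mono sum_mono2 mdd.reach_sum_nonneg \<psi>_nonneg) auto
  also have "\<dots> \<le> s * (?Z V * \<psi> x * (a / (a - s)\<^sup>2))"
    by (intro mult_left_mono s_nonneg s_less mdd.sum_reach_sum_le[OF finite_V subset_refl x] w_diag
        w_off w_off_tilted \<psi>_nonneg)
  finally have "?Z V * \<psi> x + 2 * (\<Sum>z\<in>V - {x}. w x z * mdd.reach_sum \<psi> V x z)
      \<le> ?Z V * \<psi> x + 2 * (s * (?Z V * \<psi> x * (a / (a - s)\<^sup>2)))"
    by (intro add_left_mono mult_left_mono) simp_all
  also have "\<dots> = ?Z V * ((1 + 2 * s * (a / (a - s)\<^sup>2)) * \<psi> x)"
    by (simp add: algebra_simps)
  also have "\<dots> \<le> ?Z V * (tilt_const a s * \<psi> x)"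
    using Z by (intro mult_left_mono mult_right_mono tilt_const_ge[OF s_nonneg s_less] \<psi>_nonneg) simp
  finally have bound: "(\<Sum>c\<in>closed_matchings V w. matching_weight w V c *
      (\<Sum>y\<in>V \<inter> matching_reach x c. \<psi> y)) \<le> ?Z V * (tilt_const a s * \<psi> x)"
    using sum_matching_loop_le[of V x w \<psi>, OF finite_V x w_nonneg w_sym \<psi>_nonneg]
    unfolding mdd.reach_sum_def by linarith
  have fin: "finite (mdd_configs V w)"
    by (simp add: mdd_configs_eq[OF finite_V] finite_matchings[OF finite_V])
  have "(\<Sum>y\<in>V. \<psi> y * measure (mdd_measure V w) {m \<in> mdd_configs V w. y \<in> mdd_loop V w x m})
      = (\<Sum>m\<in>mdd_configs V w. mdd_weight V w V m / mdd_Z V w * (\<Sum>y\<in>V \<inter> mdd_loop V w x m. \<psi> y))"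
    unfolding mdd_measure_def
    using fin finite_V Z mdd_weight_nonneg[of w V V] w_nonneg w_sym
    by (intro sum_measure_point_measure) (simp_all add: mdd_Z_eq)
  also have "\<dots> = (\<Sum>m\<in>mdd_configs V w. mdd_weight V w V m * (\<Sum>y\<in>V \<inter> mdd_loop V w x m. \<psi> y)) / ?Z V"
    by (simp add: sum_divide_distrib mdd_Z_eq[OF finite_V])
  also have "(\<Sum>m\<in>mdd_configs V w. mdd_weight V w V m * (\<Sum>y\<in>V \<inter> mdd_loop V w x m. \<psi> y))
      = (\<Sum>c\<in>closed_matchings V w. matching_weight w V c * (\<Sum>y\<in>V \<inter> matching_reach x c. \<psi> y))"
    unfolding sum_mdd_configs[OF finite_V]
    by (intro sum.cong) (auto simp: mdd_weight_closed[OF finite_V] mdd_loop_indicator_config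
        closed_matchings_def)
  also have "\<dots> / ?Z V \<le> tilt_const a s * \<psi> x"
    using bound Z by (simp add: divide_le_eq mult.commute)
  finally show ?thesis .
qed

end

section \<open>The torus\<close>

lemma norm1_nonneg: "0 \<le> norm1 x"
  by (simp add: norm1_def sum_nonneg)

lemma norm1_triangle: "norm1 (x + y) \<le> norm1 x + norm1 y"
  unfolding norm1_def of_int_add[symmetric] of_int_le_iff sum.distrib[symmetric]
  by (intro sum_mono) simp

lemma torus_norm1_le: "torus_norm1 L x \<le> norm1 (x + int L *s z)"
  unfolding torus_norm1_def by (intro cINF_lower bdd_belowI2[of _ 0] norm1_nonneg) auto

lemma torus_norm1_le_norm1: "torus_norm1 L x \<le> norm1 x"
  using torus_norm1_le[of L x 0] by simp

lemma torus_norm1_nonneg: "0 \<le> torus_norm1 L x"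
  unfolding torus_norm1_def by (intro cINF_greatest norm1_nonneg) auto

lemma torus_norm1_0: "torus_norm1 L (0 :: int ^ 'd) = 0"
  using torus_norm1_le_norm1[of L "0 :: int ^ 'd"] torus_norm1_nonneg[of L "0 :: int ^ 'd"] by (simp add: norm1_def)

lemma torus_norm1_triangle: "torus_norm1 L (x + y) \<le> torus_norm1 L x + torus_norm1 L y"
proof -
  have 1: "torus_norm1 L (x + y) - norm1 (x + int L *s z) \<le> torus_norm1 L y" for z
    unfolding torus_norm1_def[of L y]
  proof (rule cINF_greatest)
    fix z'
    have "torus_norm1 L (x + y) \<le> norm1 ((x + int L *s z) + (y + int L *s z'))"
      using torus_norm1_le[of L "x + y" "z + z'"] by (simp add: vector_add_ldistrib add_ac)
    also have "\<dots> \<le> norm1 (x + int L *s z) + norm1 (y + int L *s z')"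
      by (rule norm1_triangle)
    finally show "torus_norm1 L (x + y) - norm1 (x + int L *s z) \<le> norm1 (y + int L *s z')"
      by simp
  qed simp
  have "torus_norm1 L (x + y) - torus_norm1 L y \<le> torus_norm1 L x"
    unfolding torus_norm1_def[of L x]
  proof (rule cINF_greatest)
    show "torus_norm1 L (x + y) - torus_norm1 L y \<le> norm1 (x + int L *s z)" for z
      using 1[of z] by simp
  qed simp
  then show ?thesis by simp
qed

lemma finite_torus: "finite (torus L :: (int ^ 'd) set)"
proof (rule finite_subset)
  show "(torus L :: (int ^ 'd) set) \<subseteq> vec_lambda ` (UNIV \<rightarrow>\<^sub>E {0..<int L})"
  proof
    fix x :: "int ^ 'd" assume "x \<in> torus L"
    then have "(\<lambda>i. x $ i) \<in> UNIV \<rightarrow>\<^sub>E {0..<int L}"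
      by (auto simp: torus_def)
    then show "x \<in> vec_lambda ` (UNIV \<rightarrow>\<^sub>E {0..<int L})"
      by (rule rev_image_eqI) simp
  qed
  show "finite (vec_lambda ` (UNIV \<rightarrow>\<^sub>E {0..<int L}) :: (int ^ 'd) set)"
    by (intro finite_imageI finite_PiE) auto
qed

lemma zero_in_torus: "1 \<le> L \<Longrightarrow> 0 \<in> torus L"
  by (simp add: torus_def)

lemma torus_shift_eq:
  assumes "u \<in> torus L" "v \<in> torus L" "u + int L *s z = v + int L *s z'"
  shows "u = v"
proof -
  have "u $ i = v $ i" for i
  proof -
    have "u $ i + int L * z $ i = v $ i + int L * z' $ i"
      using arg_cong[OF assms(3), of "\<lambda>x. x $ i"] by simp
    then have "(u $ i) mod int L = (v $ i) mod int L"
      by (metis mod_mult_self2)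
    then show ?thesis
      using assms(1,2) by (simp add: torus_def)
  qed
  then show ?thesis by (simp add: vec_eq_iff)
qed

lemma inj_shift: "1 \<le> L \<Longrightarrow> inj (\<lambda>z. c + int L *s z)"
  by (auto simp: inj_def vec_eq_iff)

context
  fixes w :: "int ^ 'd \<Rightarrow> real" and L :: nat
  assumes w_nonneg: "\<And>x. 0 \<le> w x" and w_summable: "w summable_on UNIV" and L: "1 \<le> L"
begin

lemma summable_on_shift:
  fixes f :: "int ^ 'd \<Rightarrow> real"
  assumes "f summable_on UNIV"
  shows "(\<lambda>z. f (c + int L *s z)) summable_on UNIV"
  using summable_on_reindex[OF inj_shift[OF L, of c], of f] summable_on_subset_banach[OF assms]
  by (simp add: o_def)

lemma periodised_nonneg: "0 \<le> periodised L w x y"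
  unfolding periodised_def by (intro infsum_nonneg w_nonneg)

lemma periodised_sym:
  assumes "\<And>x. w x = w (- x)"
  shows "periodised L w x y = periodised L w y x"
proof -
  have "periodised L w x y = (\<Sum>\<^sub>\<infinity>z. w (y - x + int L *s - z))"
    unfolding periodised_def
    using infsum_reindex[of uminus UNIV "\<lambda>z. w (y - x + int L *s z)"]
    by (simp add: o_def surj_uminus)
  also have "\<dots> = periodised L w y x"
    unfolding periodised_def
  proof (rule infsum_cong)
    fix z
    have "w (y - x + int L *s - z) = w (- (y - x + int L *s - z))"
      by (rule assms)
    also have "- (y - x + int L *s - z) = x - y + int L *s z"
      by simp
    finally show "w (y - x + int L *s - z) = w (x - y + int L *s z)" .
  qed
  finally show ?thesis .
qed

lemma periodised_diag: "w 0 \<le> periodised L w x x"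
  using finite_sum_le_infsum[OF summable_on_shift[OF w_summable, of 0], of "{0}"] w_nonneg
  by (simp add: periodised_def)

text \<open>Unfolding the periodisation lists the lattice points \<open>u - x + L z\<close>. They
  are pairwise distinct and nonzero because the torus consists of unique representatives and
  \<open>u\<close> differs from \<open>x\<close>. The torus distance is at most the norm of each
  such lift, so monotonicity of \<open>\<phi>\<close> compares the terms; the right side no longer
  involves \<open>L\<close> or \<open>x\<close>.\<close>

lemma sum_periodised_le:
  assumes x: "x \<in> torus L" and \<phi>: "\<And>r. 0 \<le> r \<Longrightarrow> 0 \<le> \<phi> r" "mono_on {0..} \<phi>"
    and summable: "(\<lambda>v. w v * \<phi> (norm1 v)) summable_on UNIV"
  shows "(\<Sum>u\<in>torus L - {x}. periodised L w x u * \<phi> (torus_norm1 L (u - x)))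
    \<le> infsum (\<lambda>v. w v * \<phi> (norm1 v)) (UNIV - {0})"
proof -
  let ?g = "\<lambda>v. w v * \<phi> (norm1 v)"
  let ?S = "(torus L - {x}) \<times> (UNIV :: (int ^ 'd) set)"
  let ?h = "\<lambda>(u, z). u - x + int L *s z"
  have g: "0 \<le> ?g v" for v
    using w_nonneg[of v] \<phi>(1)[OF norm1_nonneg[of v]] by simp
  have inj: "inj_on ?h ?S"
  proof (rule inj_onI)
    fix p q assume pq: "p \<in> ?S" "q \<in> ?S" "?h p = ?h q"
    obtain u z v z' where [simp]: "p = (u, z)" "q = (v, z')"
      by (cases p, cases q)
    have uv: "u \<in> torus L" "v \<in> torus L" "u - x + int L *s z = v - x + int L *s z'"
      using pq by simp_all
    then have "u + int L *s z = v + int L *s z'"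
      by (simp add: algebra_simps)
    then have eq: "u = v"
      by (rule torus_shift_eq[OF uv(1,2)])
    moreover have "z = z'"
      by (rule injD[OF inj_shift[OF L, of "u - x"]]) (use uv(3) eq in simp)
    ultimately show "p = q" by simp
  qed
  have sub: "?h ` ?S \<subseteq> UNIV - {0}"
  proof (rule image_subsetI)
    fix p assume p: "p \<in> ?S"
    obtain u z where [simp]: "p = (u, z)" by (cases p)
    have "?h p \<noteq> 0"
    proof
      assume "?h p = 0"
      then have "u + int L *s z = x + int L *s 0"
        by (simp add: algebra_simps)
      from torus_shift_eq[OF _ x this] p show False by simp
    qed
    then show "?h p \<in> UNIV - {0}" by simp
  qed
  have summable_h: "(\<lambda>p. ?g (?h p)) summable_on ?S"
    using summable_on_reindex[OF inj, of ?g] summable_on_subset_banach[OF summable] by (simp add: o_def)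
  have "(\<Sum>u\<in>torus L - {x}. periodised L w x u * \<phi> (torus_norm1 L (u - x)))
      \<le> (\<Sum>u\<in>torus L - {x}. \<Sum>\<^sub>\<infinity>z. ?g (u - x + int L *s z))"
  proof (rule sum_mono)
    fix u
    have "periodised L w x u * \<phi> (torus_norm1 L (u - x))
        = (\<Sum>\<^sub>\<infinity>z. w (u - x + int L *s z) * \<phi> (torus_norm1 L (u - x)))"
      unfolding periodised_def by (rule infsum_cmult_left'[symmetric])
    also have "\<dots> \<le> (\<Sum>\<^sub>\<infinity>z. ?g (u - x + int L *s z))"
    proof (rule infsum_mono)
      show "w (u - x + int L *s z) * \<phi> (torus_norm1 L (u - x)) \<le> ?g (u - x + int L *s z)" for z
        using torus_norm1_le[of L "u - x" z] torus_norm1_nonneg[of L "u - x"] norm1_nonneg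
        by (intro mult_left_mono w_nonneg mono_onD[OF \<phi>(2)]) auto
    qed (intro summable_on_cmult_left summable_on_shift w_summable summable)+
    finally show "periodised L w x u * \<phi> (torus_norm1 L (u - x))
      \<le> (\<Sum>\<^sub>\<infinity>z. ?g (u - x + int L *s z))" .
  qed
  also have "\<dots> = (\<Sum>\<^sub>\<infinity>u\<in>torus L - {x}. \<Sum>\<^sub>\<infinity>z. ?g (?h (u, z)))"
    by (simp add: finite_torus)
  also have "\<dots> = infsum (\<lambda>p. ?g (?h p)) ?S"
    using infsum_Sigma_banach[OF summable_h] by simp
  also have "\<dots> = infsum ?g (?h ` ?S)"
    using infsum_reindex[OF inj, of ?g] by (simp add: o_def)
  also have "\<dots> \<le> infsum ?g (UNIV - {0})"
    using g sub by (intro infsum_mono_neutral summable_on_subset_banach[OF summable]) auto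
  finally show ?thesis .
qed

end

lemma exists_small_tilt:
  fixes w :: "int ^ 'd \<Rightarrow> real"
  assumes w_nonneg: "\<And>x. 0 \<le> w x" and w_sum: "(w has_sum 1) UNIV" and w_0: "1 / 2 < w 0"
    and summable: "(\<lambda>v. w v * \<Phi> (norm1 v)) summable_on UNIV"
    and \<Phi>: "\<And>r. 0 \<le> r \<Longrightarrow> 0 \<le> \<Phi> r" "mono_on {0..} \<Phi>" "isCont \<Phi> 0" "\<Phi> 0 = 1"
  obtains \<epsilon> where "0 < \<epsilon>" "\<epsilon> \<le> 1" "(\<lambda>v. w v * \<Phi> (\<epsilon> * norm1 v)) summable_on UNIV"
    "infsum (\<lambda>v. w v * \<Phi> (\<epsilon> * norm1 v)) (UNIV - {0}) \<le> 1 / 2"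
proof -
  let ?g = "\<lambda>v. w v * \<Phi> (norm1 v)" and ?h = "\<lambda>\<epsilon> v. w v * \<Phi> (\<epsilon> * norm1 v)"
  \<comment> \<open>Half of the slack: the part inside \<open>F\<close> is at most
    \<open>1 - w 0 + \<delta>\<close> and the part outside at most \<open>\<delta>\<close>, which
    add up to exactly 1/2.\<close>
  define \<delta> where "\<delta> = (w 0 - 1 / 2) / 2"
  have \<delta>: "0 < \<delta>" using w_0 by (simp add: \<delta>_def)
  have g: "0 \<le> ?g v" for v
    using w_nonneg[of v] \<Phi>(1)[OF norm1_nonneg[of v]] by simp
  have "\<forall>\<^sub>F F in finite_subsets_at_top UNIV. dist (sum ?g F) (infsum ?g UNIV) < \<delta>"
    using has_sum_infsum[OF summable] \<delta> by (auto simp: has_sum_def tendsto_iff)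
  then obtain F where F: "finite F" "dist (sum ?g F) (infsum ?g UNIV) < \<delta>"
    by (auto simp: eventually_finite_subsets_at_top)
  have "((\<lambda>\<epsilon>. \<Sum>v\<in>F - {0}. ?h \<epsilon> v) \<longlongrightarrow> (\<Sum>v\<in>F - {0}. w v * \<Phi> 0)) (at_right 0)"
    by (intro tendsto_sum tendsto_mult tendsto_const isCont_tendsto_compose[OF \<Phi>(3)])
       (auto intro!: tendsto_eq_intros)
  then have "\<forall>\<^sub>F \<epsilon> in at_right 0. (\<Sum>v\<in>F - {0}. ?h \<epsilon> v) < (\<Sum>v\<in>F - {0}. w v * \<Phi> 0) + \<delta>"
    by (rule order_tendstoD) (use \<delta> in simp)
  moreover have "\<forall>\<^sub>F \<epsilon> in at_right (0::real). 0 < \<epsilon>" "\<forall>\<^sub>F \<epsilon> in at_right (0::real). \<epsilon> < 1"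
    by (auto intro: eventually_at_right_less eventually_at_rightI[of 0 1])
  ultimately have "\<forall>\<^sub>F \<epsilon> in at_right 0. 0 < \<epsilon> \<and> \<epsilon> < 1 \<and>
      (\<Sum>v\<in>F - {0}. ?h \<epsilon> v) < (\<Sum>v\<in>F - {0}. w v * \<Phi> 0) + \<delta>"
    by eventually_elim auto
  then obtain \<epsilon> where \<epsilon>: "0 < \<epsilon>" "\<epsilon> < 1"
    and near: "(\<Sum>v\<in>F - {0}. ?h \<epsilon> v) < (\<Sum>v\<in>F - {0}. w v * \<Phi> 0) + \<delta>"
    using eventually_happens'[OF trivial_limit_at_right_real] by blast
  have h: "0 \<le> ?h \<epsilon> v" "?h \<epsilon> v \<le> ?g v" for v
  proof -
    have "0 \<le> \<epsilon> * norm1 v" "\<epsilon> * norm1 v \<le> norm1 v"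
      using \<epsilon> norm1_nonneg[of v] by (auto intro: mult_left_le_one_le)
    then show "0 \<le> ?h \<epsilon> v" "?h \<epsilon> v \<le> ?g v"
      using w_nonneg \<Phi>(1) by (auto intro!: mult_left_mono mono_onD[OF \<Phi>(2)])
  qed
  have summable_h: "?h \<epsilon> summable_on UNIV"
    by (rule summable_on_comparison_test[OF summable]) (use h in auto)
  have "infsum (?h \<epsilon>) (UNIV - {0}) \<le> 1 / 2"
  proof (rule infsum_le_finite_sums)
    show "?h \<epsilon> summable_on UNIV - {0}"
      by (rule summable_on_subset_banach[OF summable_h]) simp
    fix F' assume F': "finite F'" "F' \<subseteq> UNIV - {0 :: int ^ 'd}"
    \<comment> \<open>The origin may lie in \<open>F\<close> but not in \<open>F'\<close>, hence the
      split into \<open>F - {0}\<close> and \<open>F' - F\<close>.\<close>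
    have "sum (?h \<epsilon>) F' \<le> sum (?h \<epsilon>) ((F - {0}) \<union> (F' - F))"
      using F F' h by (intro sum_mono2) auto
    also have "\<dots> = sum (?h \<epsilon>) (F - {0}) + sum (?h \<epsilon>) (F' - F)"
      using F F' by (intro sum.union_disjoint) auto
    also have "sum (?h \<epsilon>) (F - {0}) \<le> 1 - w 0 + \<delta>"
    proof -
      have "w 0 + (\<Sum>v\<in>F - {0}. w v) = sum w (insert 0 F)"
        using F by (simp add: sum.insert_remove)
      also have "\<dots> \<le> infsum w UNIV"
        using F w_nonneg has_sum_imp_summable[OF w_sum] by (intro finite_sum_le_infsum) auto
      also have "\<dots> = 1"
        using w_sum by (rule infsumI)
      finally show ?thesis using near \<Phi>(4) by simp
    qed
    also have "sum (?h \<epsilon>) (F' - F) \<le> sum ?g (F' - F)"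
      using h by (intro sum_mono)
    also have "\<dots> = sum ?g (F \<union> F') - sum ?g F"
      using F F' sum.union_disjoint[of F "F' - F" ?g] by simp
    also have "\<dots> \<le> \<delta>"
      using F finite_sum_le_infsum[OF summable, of "F \<union> F'"] F' g by (auto simp: dist_real_def)
    finally show "sum (?h \<epsilon>) F' \<le> 1 / 2"
      by (simp add: \<delta>_def)
  qed
  with \<epsilon> summable_h show ?thesis
    by (intro that[of \<epsilon>]) auto
qed

section \<open>Decay of the four functions on the torus\<close>

context
  fixes w :: "int ^ 'd \<Rightarrow> real" and F :: "nat \<Rightarrow> int ^ 'd \<Rightarrow> real"
  assumes w_nonneg: "\<And>x. w x \<ge> 0"
    and w_sym: "\<And>x. w x = w (- x)"
    and w_sum: "(w has_sum 1) UNIV"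
    and w_0: "w 0 > 1 / 2"
    and F: "F \<in> {G_mdd w, loop_prob_mdd w, G_per w, loop_prob_per w}"
begin

private abbreviation \<kappa> where "\<kappa> \<equiv> tilt_const (w 0) (1 / 2)"

lemma F_nonneg:
  assumes "1 \<le> L"
  shows "0 \<le> F L x"
proof -
  note W = periodised_nonneg[OF w_nonneg has_sum_imp_summable[OF w_sum] assms]
    periodised_sym[OF w_nonneg has_sum_imp_summable[OF w_sum] assms w_sym]
  have "0 \<le> mdd_Z (torus L) (periodised L w)"
    unfolding mdd_Z_def by (intro sum_nonneg mdd_weight_nonneg W)
  then have "0 \<le> G_mdd w L x"
    by (auto simp: G_mdd_def mdd_G_def intro!: divide_nonneg_nonneg sum_nonneg mdd_weight_nonneg W)
  moreover have "0 \<le> G_per w L x"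
    by (auto simp: G_per_def per_G_def per_Z_def intro!: divide_nonneg_nonneg sum_nonneg prod_nonneg W)
  ultimately show ?thesis
    using F by (auto simp: loop_prob_mdd_def loop_prob_per_def)
qed

text \<open>Submultiplicativity reduces the supersolution condition at every \<open>x\<close> to the
  single tilted row sum around the origin. The bound \<open>\<kappa>\<close> depends on
  \<open>w 0\<close> alone: \<open>\<Phi>\<close> influences only the scale
  \<open>\<epsilon>\<close>, and \<open>\<epsilon>\<close> does not depend on
  \<open>L\<close>.\<close>

lemma moment_bound:
  assumes \<Phi>: "\<And>r. 0 \<le> r \<Longrightarrow> 1 \<le> \<Phi> r" "mono_on {0..} \<Phi>" "isCont \<Phi> 0" "\<Phi> 0 = 1"
    and submult: "\<And>r t. 0 \<le> r \<Longrightarrow> 0 \<le> t \<Longrightarrow> \<Phi> (r + t) \<le> \<Phi> r * \<Phi> t"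
    and summable: "(\<lambda>v. w v * \<Phi> (norm1 v)) summable_on UNIV"
  obtains \<epsilon> where "0 < \<epsilon>" "\<epsilon> \<le> 1"
    "\<And>L. 1 \<le> L \<Longrightarrow> (\<Sum>y\<in>torus L. \<Phi> (\<epsilon> * torus_norm1 L y) * F L y) \<le> \<kappa>"
proof -
  have \<Phi>0: "0 \<le> \<Phi> r" if "0 \<le> r" for r
    using \<Phi>(1)[OF that] by simp
  obtain \<epsilon> where \<epsilon>: "0 < \<epsilon>" "\<epsilon> \<le> 1" "(\<lambda>v. w v * \<Phi> (\<epsilon> * norm1 v)) summable_on UNIV"
    "infsum (\<lambda>v. w v * \<Phi> (\<epsilon> * norm1 v)) (UNIV - {0}) \<le> 1 / 2"
    using exists_small_tilt[OF w_nonneg w_sum w_0 summable \<Phi>0 \<Phi>(2-4)] by blast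
  have "(\<Sum>y\<in>torus L. \<Phi> (\<epsilon> * torus_norm1 L y) * F L y) \<le> \<kappa>" if L: "1 \<le> L" for L
  proof -
    let ?W = "periodised L w" and ?\<psi> = "\<lambda>y :: int ^ 'd. \<Phi> (\<epsilon> * torus_norm1 L y)"
    let ?T = "torus L :: (int ^ 'd) set"
    note w = w_nonneg has_sum_imp_summable[OF w_sum] L
    note W = periodised_nonneg[OF w] periodised_sym[OF w w_sym] periodised_diag[OF w]
    have d: "0 \<le> \<epsilon> * torus_norm1 L y" for y :: "int ^ 'd"
      using \<epsilon> torus_norm1_nonneg[of L y] by simp
    have tilt: "(\<Sum>u\<in>?T - {x}. ?W x u * ?\<psi> (u - x)) \<le> 1 / 2" if x: "x \<in> ?T" for x
    proof -
      have "mono_on {0..} (\<lambda>r. \<Phi> (\<epsilon> * r))"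
        using \<epsilon>(1) by (auto intro!: mono_onI mono_onD[OF \<Phi>(2)] mult_left_mono)
      from sum_periodised_le[OF w x _ this \<epsilon>(3)] \<epsilon>(1,4) \<Phi>0 show ?thesis
        by fastforce
    qed
    interpret tilted_weights ?T ?W ?\<psi> "w 0" "1 / 2"
    proof
      show "0 \<le> ?\<psi> x" for x
        by (intro \<Phi>0 d)
      fix x assume x: "x \<in> ?T"
      have "(\<Sum>u\<in>?T - {x}. ?W x u) \<le> (\<Sum>u\<in>?T - {x}. ?W x u * ?\<psi> (u - x))"
        using W(1) mult_left_mono[OF \<Phi>(1)[OF d] W(1)] by (intro sum_mono) simp
      also note tilt[OF x]
      finally show "(\<Sum>u\<in>?T - {x}. ?W x u) \<le> 1 / 2" .
      \<comment> \<open>The triangle inequality together with submultiplicativity gives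
        \<open>\<psi> u \<le> \<psi> x * \<psi> (u - x)\<close>, so the factor
        \<open>\<psi> x\<close> can be pulled out.\<close>
      have "(\<Sum>u\<in>?T - {x}. ?W x u * ?\<psi> u) \<le> (\<Sum>u\<in>?T - {x}. (?W x u * ?\<psi> (u - x)) * ?\<psi> x)"
      proof (rule sum_mono)
        fix u
        have "\<epsilon> * torus_norm1 L u \<le> \<epsilon> * torus_norm1 L x + \<epsilon> * torus_norm1 L (u - x)"
          using mult_left_mono[OF torus_norm1_triangle[of L x "u - x"], of \<epsilon>] \<epsilon>(1)
          by (simp add: distrib_left)
        then have "?\<psi> u \<le> \<Phi> (\<epsilon> * torus_norm1 L x + \<epsilon> * torus_norm1 L (u - x))"
          using d[of u] d[of x] d[of "u - x"] by (intro mono_onD[OF \<Phi>(2)]) auto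
        also have "\<dots> \<le> ?\<psi> x * ?\<psi> (u - x)"
          by (intro submult d)
        finally have "?W x u * ?\<psi> u \<le> ?W x u * (?\<psi> x * ?\<psi> (u - x))"
          by (intro mult_left_mono W(1))
        then show "?W x u * ?\<psi> u \<le> (?W x u * ?\<psi> (u - x)) * ?\<psi> x"
          by (simp add: mult_ac)
      qed
      also have "\<dots> = (\<Sum>u\<in>?T - {x}. ?W x u * ?\<psi> (u - x)) * ?\<psi> x"
        by (simp add: sum_distrib_right)
      also have "\<dots> \<le> 1 / 2 * ?\<psi> x"
        by (intro mult_right_mono tilt x \<Phi>0 d)
      finally show "(\<Sum>u\<in>?T - {x}. ?W x u * ?\<psi> u) \<le> 1 / 2 * ?\<psi> x" .
    qed (use W w_0 finite_torus in auto)
    have zero: "0 \<in> ?T" "?\<psi> 0 = 1"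
      using zero_in_torus[OF L] \<Phi>(4) by (simp_all add: torus_norm1_0)
    show ?thesis
      using F sum_mdd_G_le[OF zero(1)] sum_per_G_le[OF zero(1)] sum_per_loop_prob_le[OF zero(1)]
        sum_mdd_loop_prob_le[OF zero(1)]
      by (elim insertE emptyE)
         (simp_all add: zero(2) G_mdd_def G_per_def loop_prob_mdd_def loop_prob_per_def)
  qed
  with \<epsilon>(1,2) show ?thesis by (rule that)
qed

lemma kappa_pos: "0 < \<kappa>"
  using tilt_const_ge(4)[of "1 / 2" "w 0"] w_0 by simp

lemma pointwise_bound:
  assumes \<Phi>: "\<And>r. 0 \<le> r \<Longrightarrow> 1 \<le> \<Phi> r" "mono_on {0..} \<Phi>" "isCont \<Phi> 0" "\<Phi> 0 = 1"
    and submult: "\<And>r t. 0 \<le> r \<Longrightarrow> 0 \<le> t \<Longrightarrow> \<Phi> (r + t) \<le> \<Phi> r * \<Phi> t"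
    and summable: "(\<lambda>v. w v * \<Phi> (norm1 v)) summable_on UNIV"
  obtains \<epsilon> where "0 < \<epsilon>" "\<epsilon> \<le> 1"
    "\<And>L x. 1 \<le> L \<Longrightarrow> x \<in> torus L \<Longrightarrow> F L x \<le> \<kappa> / \<Phi> (\<epsilon> * torus_norm1 L x)"
proof -
  obtain \<epsilon> where \<epsilon>: "0 < \<epsilon>" "\<epsilon> \<le> 1"
    and sum: "\<And>L. 1 \<le> L \<Longrightarrow> (\<Sum>y\<in>torus L. \<Phi> (\<epsilon> * torus_norm1 L y) * F L y) \<le> \<kappa>"
    using moment_bound[OF assms] by blast
  have "F L x \<le> \<kappa> / \<Phi> (\<epsilon> * torus_norm1 L x)" if L: "1 \<le> L" and x: "x \<in> torus L" for L x
  proof -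
    have pos: "1 \<le> \<Phi> (\<epsilon> * torus_norm1 L y)" for y :: "int ^ 'd"
      using \<epsilon> torus_norm1_nonneg[of L y] by (intro \<Phi>(1)) simp
    have "\<Phi> (\<epsilon> * torus_norm1 L x) * F L x \<le> (\<Sum>y\<in>torus L. \<Phi> (\<epsilon> * torus_norm1 L y) * F L y)"
      using pos order_trans[OF zero_le_one pos] F_nonneg[OF L]
      by (intro member_le_sum x finite_torus mult_nonneg_nonneg) auto
    also note sum[OF L]
    finally show ?thesis
      using pos[of x] by (simp add: le_divide_eq mult.commute)
  qed
  with \<epsilon> show ?thesis by (rule that)
qed

text \<open>Only summability of \<open>w\<close> is available, so the weight has to be bounded: an
  exponential truncated at height \<open>K\<close>. As \<open>\<kappa>\<close> does not depend on
  the weight, \<open>K\<close> can be chosen after it, and tails beyond the radius where the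
  truncation sets in are at most \<open>\<kappa> / K\<close>.\<close>

lemma uniform_tail:
  "((\<lambda>R::real. SUP L\<in>{1..}. ereal (\<Sum>x | x \<in> torus L \<and> torus_norm1 L x \<ge> R. F L x)) \<longlongrightarrow> 0) at_top"
    (is "(?S \<longlongrightarrow> 0) at_top")
proof (rule order_tendstoI)
  note F0 = F_nonneg
  fix a :: ereal
  {
    assume "a < 0"
    moreover have "0 \<le> ?S R" for R
      \<comment> \<open>The torus with \<open>L = 1\<close> serves as witness that the supremum is
        nonnegative.\<close>
      by (rule SUP_upper2[of 1]) (auto intro!: sum_nonneg F0)
    ultimately have "a < ?S R" for R
      by (rule less_le_trans)
    then show "\<forall>\<^sub>F R in at_top. a < ?S R"
      by (intro always_eventually allI)
  }
  assume "0 < a"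
  then obtain r where r: "0 < ereal r" "ereal r < a"
    using ereal_dense2 by blast
  \<comment> \<open>\<open>\<kappa> / r\<close> makes the tail at most \<open>r\<close>; the maximum
    with 1 keeps the truncated exponential at least 1 and submultiplicative.\<close>
  define K where "K = max 1 (\<kappa> / r)"
  let ?\<Phi> = "\<lambda>t::real. min (exp t) K"
  have K: "1 \<le> K" "\<kappa> \<le> r * K"
    using r(1) by (auto simp: K_def max_def field_simps)
  have \<Phi>: "1 \<le> ?\<Phi> t" if "0 \<le> t" for t
    using that K by simp
  have submult: "?\<Phi> (t + u) \<le> ?\<Phi> t * ?\<Phi> u" if "0 \<le> t" "0 \<le> u" for t u
  proof -
    have "K \<le> ?\<Phi> t * K" "K \<le> K * ?\<Phi> u"
      using K \<Phi>[OF that(1)] \<Phi>[OF that(2)] by (simp_all add: mult_le_cancel_right1 mult_le_cancel_left1)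
    moreover have "?\<Phi> t = exp t \<and> ?\<Phi> u = exp u \<or> ?\<Phi> t = K \<or> ?\<Phi> u = K"
      by (auto simp: min_def)
    ultimately show ?thesis
      by (auto simp only: exp_add min.cobounded1 intro: min.coboundedI2)
  qed
  have summable: "(\<lambda>v. w v * ?\<Phi> (norm1 v)) summable_on UNIV"
    by (rule summable_on_comparison_test[OF summable_on_cmult_left[OF has_sum_imp_summable[OF w_sum], of K]])
       (use w_nonneg K in \<open>auto intro!: mult_left_mono mult_nonneg_nonneg\<close>)
  have mono: "mono_on {0..} ?\<Phi>"
    by (intro mono_onI min.mono) simp_all
  have cont: "isCont ?\<Phi> 0"
    by (intro continuous_intros)
  have zero: "?\<Phi> 0 = 1"
    using K by simp
  obtain \<epsilon> where \<epsilon>: "0 < \<epsilon>" "\<epsilon> \<le> 1"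
    and sum: "\<And>L. 1 \<le> L \<Longrightarrow> (\<Sum>y\<in>torus L. ?\<Phi> (\<epsilon> * torus_norm1 L y) * F L y) \<le> \<kappa>"
    by (rule moment_bound[where \<Phi> = ?\<Phi>,
          OF \<Phi> mono cont zero submult summable]) blast+
  have "?S R \<le> ereal r" if R: "R \<ge> ln K / \<epsilon>" for R
  proof (rule SUP_least)
    fix L :: nat assume "L \<in> {1..}"
    then have L: "1 \<le> L" by simp
    let ?B = "{x :: int ^ 'd. x \<in> torus L \<and> torus_norm1 L x \<ge> R}"
    \<comment> \<open>Beyond \<open>ln K / \<epsilon>\<close>, a radius independent of
      \<open>L\<close>, the truncation is active.\<close>
    have large: "?\<Phi> (\<epsilon> * torus_norm1 L x) = K" if "x \<in> ?B" for x
    proof -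
      have "ln K / \<epsilon> \<le> torus_norm1 L x"
        using that R by simp
      then have "exp (ln K) \<le> exp (\<epsilon> * torus_norm1 L x)"
        using \<epsilon> by (simp add: divide_le_eq mult.commute)
      then show ?thesis
        using K(1) by simp
    qed
    have "K * (\<Sum>x\<in>?B. F L x) = (\<Sum>x\<in>?B. ?\<Phi> (\<epsilon> * torus_norm1 L x) * F L x)"
      unfolding sum_distrib_left by (intro sum.cong refl) (simp only: large)
    also have "\<dots> \<le> (\<Sum>x\<in>torus L. ?\<Phi> (\<epsilon> * torus_norm1 L x) * F L x)"
      using K by (intro sum_mono2 finite_torus mult_nonneg_nonneg F0 L) auto
    also have "\<dots> \<le> \<kappa>" by (rule sum[OF L])
    also have "\<dots> \<le> K * r" using K by (simp add: mult.commute)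
    finally show "ereal (\<Sum>x\<in>?B. F L x) \<le> ereal r"
      using K(1) by simp
  qed
  then show "\<forall>\<^sub>F R in at_top. ?S R < a"
    using r(2) unfolding eventually_at_top_linorder by (meson le_less_trans)
qed

lemma polynomial_decay:
  fixes p :: real
  assumes p: "0 < p" and summable: "(\<lambda>x. norm1 x powr p * w x) summable_on UNIV"
  shows "\<exists>C::real. \<forall>L\<ge>1. \<forall>x\<in>torus L. F L x \<le> C * (1 + torus_norm1 L x) powr (- p)"
proof -
  let ?\<Phi> = "\<lambda>r. (1 + r) powr p"
  \<comment> \<open>The shift by 1 makes the weight submultiplicative and equal to 1 at 0; this
    comparison recovers its summability from the moment of the unshifted power.\<close>
  have le: "?\<Phi> r \<le> 2 powr p * (1 + r powr p)" if r: "0 \<le> r" for r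
  proof -
    have "?\<Phi> r \<le> (2 * max 1 r) powr p"
      using r p by (intro powr_mono2) auto
    also have "\<dots> = 2 powr p * (max 1 r) powr p"
      by (rule powr_mult)
    also have "(max 1 r) powr p \<le> 1 + r powr p"
      by (simp add: max_def)
    finally show ?thesis by simp
  qed
  have summable: "(\<lambda>v. w v * ?\<Phi> (norm1 v)) summable_on UNIV"
  proof (rule summable_on_comparison_test)
    show "(\<lambda>v. 2 powr p * (w v + norm1 v powr p * w v)) summable_on UNIV"
      by (intro summable_on_cmult_right summable_on_add summable has_sum_imp_summable[OF w_sum])
    show "w v * ?\<Phi> (norm1 v) \<le> 2 powr p * (w v + norm1 v powr p * w v)" for v
      using mult_left_mono[OF le[OF norm1_nonneg[of v]] w_nonneg[of v]] by (simp add: algebra_simps)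
  qed (use w_nonneg in simp)
  have \<Phi>: "1 \<le> ?\<Phi> r" if "0 \<le> r" for r
    using that p by (simp add: ge_one_powr_ge_zero)
  have mono: "mono_on {0..} ?\<Phi>"
    using p by (intro mono_onI powr_mono2) auto
  have cont: "isCont ?\<Phi> 0"
    by (intro continuous_intros) auto
  have submult: "?\<Phi> (r + t) \<le> ?\<Phi> r * ?\<Phi> t" if "0 \<le> r" "0 \<le> t" for r t
  proof -
    have "?\<Phi> (r + t) \<le> ((1 + r) * (1 + t)) powr p"
      using that p by (intro powr_mono2) (auto simp: algebra_simps)
    also have "\<dots> = ?\<Phi> r * ?\<Phi> t"
      by (rule powr_mult)
    finally show ?thesis .
  qed
  have zero: "?\<Phi> 0 = 1"
    by simp
  obtain \<epsilon> where \<epsilon>: "0 < \<epsilon>" "\<epsilon> \<le> 1"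
    and bound: "\<And>L x. 1 \<le> L \<Longrightarrow> x \<in> torus L \<Longrightarrow> F L x \<le> \<kappa> / ?\<Phi> (\<epsilon> * torus_norm1 L x)"
    by (rule pointwise_bound[where \<Phi> = ?\<Phi>, OF \<Phi> mono cont zero submult summable]) blast+
  have "F L x \<le> (\<kappa> / \<epsilon> powr p) * (1 + torus_norm1 L x) powr (- p)"
    if "1 \<le> L" "x \<in> torus L" for L x
  proof -
    let ?r = "torus_norm1 L x"
    have r: "0 \<le> ?r" by (rule torus_norm1_nonneg)
    have "\<epsilon> powr p * ?\<Phi> ?r = (\<epsilon> * (1 + ?r)) powr p"
      by (rule powr_mult[symmetric])
    \<comment> \<open>As \<open>\<epsilon> \<le> 1\<close>, one has
      \<open>\<epsilon> * (1 + r) \<le> 1 + \<epsilon> * r\<close>. The scale thus costs only the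
      constant factor \<open>\<epsilon> powr (- p)\<close> and leaves the exponent \<open>p\<close>
      intact.\<close>
    also have "\<dots> \<le> ?\<Phi> (\<epsilon> * ?r)"
      using \<epsilon> r p by (intro powr_mono2) (auto simp: algebra_simps)
    finally have le: "\<epsilon> powr p * ?\<Phi> ?r \<le> ?\<Phi> (\<epsilon> * ?r)" .
    have "0 < \<epsilon> powr p * ?\<Phi> ?r"
      using \<epsilon> r by simp
    then have "\<kappa> / ?\<Phi> (\<epsilon> * ?r) \<le> \<kappa> / (\<epsilon> powr p * ?\<Phi> ?r)"
      using le kappa_pos by (intro divide_left_mono mult_pos_pos) auto
    also have "\<dots> = (\<kappa> / \<epsilon> powr p) * (1 + ?r) powr (- p)"
      by (simp only: powr_minus divide_inverse inverse_mult_distrib mult.assoc)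
    finally show ?thesis
      by (rule order_trans[OF bound[OF that]])
  qed
  then show ?thesis by blast
qed

lemma exponential_decay:
  fixes \<eta> :: real
  assumes \<eta>: "0 < \<eta>" and summable: "(\<lambda>x. exp (\<eta> * norm1 x) * w x) summable_on UNIV"
  shows "\<exists>C>0. \<exists>c>0. \<forall>L\<ge>1. \<forall>x\<in>torus L. F L x \<le> C * exp (- c * torus_norm1 L x)"
proof -
  let ?\<Phi> = "\<lambda>r. exp (\<eta> * r)"
  have \<Phi>: "1 \<le> ?\<Phi> r" if "0 \<le> r" for r
    using that \<eta> by simp
  have mono: "mono_on {0..} ?\<Phi>"
    using \<eta> by (intro mono_onI) simp
  have cont: "isCont ?\<Phi> 0"
    by (intro continuous_intros)
  have zero: "?\<Phi> 0 = 1"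
    by simp
  have submult: "?\<Phi> (r + t) \<le> ?\<Phi> r * ?\<Phi> t" for r t
    by (simp add: distrib_left exp_add)
  have summable': "(\<lambda>v. w v * ?\<Phi> (norm1 v)) summable_on UNIV"
    using summable by (simp only: mult.commute)
  obtain \<epsilon> where \<epsilon>: "0 < \<epsilon>" "\<epsilon> \<le> 1"
    and bound: "\<And>L x. 1 \<le> L \<Longrightarrow> x \<in> torus L \<Longrightarrow> F L x \<le> \<kappa> / ?\<Phi> (\<epsilon> * torus_norm1 L x)"
    by (rule pointwise_bound[where \<Phi> = ?\<Phi>, OF \<Phi> mono cont zero submult summable']) blast+
  \<comment> \<open>Here the scale reduces the rate, from \<open>\<eta>\<close> to
    \<open>\<eta> * \<epsilon>\<close>.\<close>
  have "F L x \<le> \<kappa> * exp (- (\<eta> * \<epsilon>) * torus_norm1 L x)" if "1 \<le> L" "x \<in> torus L" for L x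
    using bound[OF that] by (simp only: divide_inverse exp_minus mult.assoc mult_minus_left)
  then show ?thesis
    using kappa_pos mult_pos_pos[OF \<eta> \<epsilon>(1)] by (intro exI[of _ \<kappa>] exI[of _ "\<eta> * \<epsilon>"] conjI allI impI ballI)
qed

end

theorem theorem3p6:
  fixes w :: "int ^ 'd \<Rightarrow> real" and F :: "nat \<Rightarrow> int ^ 'd \<Rightarrow> real"
  assumes w_nonneg: "\<And>x. w x \<ge> 0"
    and w_sym: "\<And>x. w x = w (- x)"
    and w_sum: "(w has_sum 1) UNIV"
    and w_0: "w 0 > 1 / 2"
    and F: "F \<in> {G_mdd w, loop_prob_mdd w, G_per w, loop_prob_per w}"
  shows "((\<lambda>R::real. SUP L\<in>{1..}. ereal (\<Sum>x | x \<in> torus L \<and> torus_norm1 L x \<ge> R. F L x))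
            \<longlongrightarrow> 0) at_top
    \<and> (\<forall>p::real. p > 0 \<and> (\<lambda>x. norm1 x powr p * w x) summable_on UNIV \<longrightarrow>
           (\<exists>C::real. \<forall>L\<ge>1. \<forall>x\<in>torus L. F L x \<le> C * (1 + torus_norm1 L x) powr (- p)))
    \<and> (\<forall>\<eta>::real. \<eta> > 0 \<and> (\<lambda>x. exp (\<eta> * norm1 x) * w x) summable_on UNIV \<longrightarrow>
           (\<exists>C>0. \<exists>c>0. \<forall>L\<ge>1. \<forall>x\<in>torus L. F L x \<le> C * exp (- c * torus_norm1 L x)))"
  by (intro conjI allI impI uniform_tail[OF assms] polynomial_decay[OF assms]
      exponential_decay[OF assms]) (elim conjE, assumption)+

end
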